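(* Let $T$ be a non-degenerate completely well-centered simplex in $\mathbb{R}^d$ with vertices ${\bf v}_0,\ldots,{\bf v}_d$, circumcenter ${\bf c}$ and circumradius $R$. For $f\in W^2(T)$ and ${\bf w}\in T$ put $$p_f({\bf w}):=\sum_{i=0}^{d}b_i(\varphi({\bf w}))\Bigl(f({\bf v}_i)+\nabla f({\bf v}_i)\cdot\bigl({\bf w}-\varphi({\bf w})+\tfrac12({\bf c}-{\bf v}_i)\bigr)\Bigr),\qquad \mathcal E({\bf w}):=\frac{R^2}{4}+|{\bf w}-\varphi({\bf w})|^2-\frac12|{\bf w}-{\bf c}|^2 .$$ Then for every ${\bf w}\in T$ the method $f\mapsto p_f({\bf w})$ is optimal for recovery of $f({\bf w})$ on the class $W^2(T)$, i.e. the mapping $\Psi^\ast:\mathbb{R}^{(d+1)^2}\to\mathbb{R}$ defined by $$\Psi^\ast(y_0,\ldots,y_d,{\bf z}_0,\ldots,{\bf z}_d):=\sum_{i=0}^{d}b_i(\varphi({\bf w}))\Bigl(y_i+{\bf z}_i\cdot\bigl({\bf w}-\varphi({\bf w})+\tfrac12({\bf c}-{\bf v}_i)\bigr)\Bigr),\qquad y_i\in\mathbb{R},\ {\bf z}_i\in\mathbb{R}^d,$$ with $p_f({\bf w})=\Psi^\ast(I(f))$, satisfies $e_{\bf w}(W^2(T);\Psi^\ast)=e_{\bf w}(W^2(T))$, and $e_{\bf w}(W^2(T))=\mathcal E({\bf w})$. Moreover, for every monotone seminorm $\|\cdot\|$ on $C(T)$, the method $p_f$ is optimal for global recovery of the class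 $W^2(T)$, i.e. the mapping $\Phi^\ast:\mathbb{R}^{(d+1)^2}\to C(T)$ with $p_f=\Phi^\ast(I(f))$ satisfies $R(W^2(T);\Phi^\ast,\|\cdot\|)=R(W^2(T);\|\cdot\|)$, and $R(W^2(T);\|\cdot\|)=\|\mathcal E\|$.
   Context: $|\cdot|$ is the Euclidean norm and ${\bf a}\cdot{\bf b}$ the dot product on $\mathbb{R}^d$. A simplex $T\subset\mathbb{R}^d$ with vertices ${\bf v}_0,\ldots,{\bf v}_d$ is non-degenerate if it is not contained in any $(d-1)$-dimensional hyperplane. The circumcenter of a simplex is the point of its affine span equidistant from all its vertices, and the circumradius is that common distance. $T$ is completely well-centered if $T$ and every face of $T$ (of any dimension) contain their circumcenters. Let ${\bf u}_i=\frac12({\bf c}+{\bf v}_i)$, $i=0,\ldots,d$, and let $U=\frac12({\bf c}+T)$ be the simplex with vertices ${\bf u}_0,\ldots,{\bf u}_d$. For ${\bf x}\in U$, $b_0({\bf x}),\ldots,b_d({\bf x})$ are the barycentric coordinates of ${\bf x}$ relative to $U$: ${\bf x}=\sum_i b_i({\bf x}){\bf u}_i$, $\sum_i b_i({\bf x})=1$, $b_i({\bf x})\ge0$. The mapping $\varphi:\mathbb{R}^d\to U$ sends ${\bf x}$ to the unique point of $U$ closest to ${\bf x}$. $C(T)$ is the space of continuous real functions on $T$ and $C^1(T)$ the space of continuously differentiable real functions on $T$. $W^2_\infty[a,b]$ is the class of functions $g:[a,b]\to\mathbb{R}$ such that $g'$ is absolutely continuous on $[a,b]$ and $|g''(t)|\le1$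 for a.e. $t\in[a,b]$ (equivalently, $g'$ exists everywhere on $[a,b]$ and $|g'(t_1)-g'(t_2)|\le|t_1-t_2|$ for all $t_1,t_2$). $W^2(T)$ is the class of $f\in C^1(T)$ such that for any two distinct points ${\bf x},{\bf y}\in T$, with $\rho=|{\bf y}-{\bf x}|$, the function $g(t)=f({\bf x}+\frac t\rho({\bf y}-{\bf x}))$, $t\in[0,\rho]$, belongs to $W^2_\infty[0,\rho]$. The information vector is $I(f):=(f({\bf v}_0),\ldots,f({\bf v}_d),\nabla f({\bf v}_0),\ldots,\nabla f({\bf v}_d))\in\mathbb{R}^{(d+1)^2}$. For ${\bf w}\in T$ and an arbitrary mapping $\Psi:\mathbb{R}^{(d+1)^2}\to\mathbb{R}$, $e_{\bf w}(W^2(T);\Psi):=\sup_{f\in W^2(T)}|f({\bf w})-\Psi(I(f))|$, and $e_{\bf w}(W^2(T)):=\inf_\Psi e_{\bf w}(W^2(T);\Psi)$ over all mappings $\Psi:\mathbb{R}^{(d+1)^2}\to\mathbb{R}$. A seminorm $\|\cdot\|$ on $C(T)$ is monotone if $\|f_1\|\le\|f_2\|$ whenever $|f_1({\bf x})|\le|f_2({\bf x})|$ for every ${\bf x}\in T$. For an arbitrary mapping $\Phi:\mathbb{R}^{(d+1)^2}\to C(T)$, $R(W^2(T);\Phi,\|\cdot\|):=\sup_{f\in W^2(T)}\|f-\Phi(I(f))\|$, and $R(W^2(T);\|\cdot\|):=\inf_\Phi R(W^2(T);\Phi,\|\cdot\|)$ over all mappings $\Phi:\mathbb{R}^{(d+1)^2}\to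 C(T)$. In $\|\mathcal E\|$, $\mathcal E$ is restricted to $T$. *)

theory Defs
  imports "HOL-Analysis.Analysis"
begin

text \<open>
  The vertices of a simplex in \<open>\<real>\<^sup>d\<close> are a family \<open>v :: 'i \<Rightarrow> real ^ 'd\<close> over a finite index type
  \<open>'i\<close> that stands for \<open>{0, \<dots>, d}\<close>; the theorem assumes \<open>CARD('i) = CARD('d) + 1\<close>.
\<close>

abbreviation simplex_hull :: "('i::finite \<Rightarrow> real ^ 'd) \<Rightarrow> (real ^ 'd) set" where
  "simplex_hull v \<equiv> convex hull (range v)"

definition nondegenerate_simplex :: "('i::finite \<Rightarrow> real ^ 'd) \<Rightarrow> bool" where
  "nondegenerate_simplex v \<longleftrightarrow> \<not> (\<exists>a b. a \<noteq> 0 \<and> simplex_hull v \<subseteq> {x. a \<bullet> x = b})"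

text \<open>
  Circumcenter and circumradius of the simplex with vertex set \<open>V\<close>. The descriptions are proper
  whenever \<open>V\<close> is non-empty and affinely independent, hence for all faces of a
  non-degenerate simplex.
\<close>

definition circumcenter :: "(real ^ 'd) set \<Rightarrow> real ^ 'd" where
  "circumcenter V = (THE c. c \<in> affine hull V \<and> (\<exists>r. \<forall>x\<in>V. dist c x = r))"

definition circumradius :: "(real ^ 'd) set \<Rightarrow> real" where
  "circumradius V = (THE r. \<forall>x\<in>V. dist (circumcenter V) x = r)"

definition completely_well_centered :: "('i::finite \<Rightarrow> real ^ 'd) \<Rightarrow> bool" where
  "completely_well_centered v \<longleftrightarrow>
     (\<forall>W. W \<subseteq> range v \<and> W \<noteq> {} \<longrightarrow> circumcenter W \<in> convex hull W)"

definition half_vertex :: "('i::finite \<Rightarrow> real ^ 'd) \<Rightarrow> 'i \<Rightarrow> real ^ 'd" where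
  "half_vertex v i = (1/2) *\<^sub>R (circumcenter (range v) + v i)"

definition barycentric :: "('i::finite \<Rightarrow> real ^ 'd) \<Rightarrow> real ^ 'd \<Rightarrow> 'i \<Rightarrow> real" where
  "barycentric u x =
     (THE b. x = (\<Sum>i\<in>UNIV. b i *\<^sub>R u i) \<and> (\<Sum>i\<in>UNIV. b i) = 1 \<and> (\<forall>i. b i \<ge> 0))"

definition proj_half :: "('i::finite \<Rightarrow> real ^ 'd) \<Rightarrow> real ^ 'd \<Rightarrow> real ^ 'd" where
  "proj_half v x = closest_point (simplex_hull (half_vertex v)) x"

text \<open>
  Functions on \<open>T\<close> are represented by total functions whose values outside \<open>T\<close> are irrelevant;
  derivatives at points of \<open>T\<close> are accordingly taken within \<open>T\<close>. If \<open>T\<close> is convex with non-empty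
  interior, the gradient within \<open>T\<close> is unique at every point of \<open>T\<close>, including the vertices.
\<close>

definition cont_fun :: "(real ^ 'd) set \<Rightarrow> (real ^ 'd \<Rightarrow> real) set" where
  "cont_fun T = {f. continuous_on T f}"

definition C1_fun :: "(real ^ 'd) set \<Rightarrow> (real ^ 'd \<Rightarrow> real) set" where
  "C1_fun T = {f. \<exists>G. continuous_on T G \<and>
     (\<forall>x\<in>T. (f has_derivative (\<lambda>h. G x \<bullet> h)) (at x within T))}"

definition grad_within :: "(real ^ 'd) set \<Rightarrow> (real ^ 'd \<Rightarrow> real) \<Rightarrow> real ^ 'd \<Rightarrow> real ^ 'd" where
  "grad_within T f x = (THE G. (f has_derivative (\<lambda>h. G \<bullet> h)) (at x within T))"

text \<open>
  The class \<open>W\<^sup>2\<^sub>\<infinity>[a,b]\<close>, with the condition that \<open>g'\<close> is absolutely continuous and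
  \<open>\<bar>g''\<bar> \<le> 1\<close> almost everywhere in its equivalent form: \<open>g'\<close> exists on all of \<open>[a,b]\<close>
  (one-sided at the end points) and is Lipschitz with constant 1.
\<close>

definition W2inf :: "real \<Rightarrow> real \<Rightarrow> (real \<Rightarrow> real) set" where
  "W2inf a b = {g. \<exists>g'. (\<forall>t\<in>{a..b}. (g has_real_derivative g' t) (at t within {a..b})) \<and>
     (\<forall>s\<in>{a..b}. \<forall>t\<in>{a..b}. \<bar>g' s - g' t\<bar> \<le> \<bar>s - t\<bar>)}"

definition W2 :: "(real ^ 'd) set \<Rightarrow> (real ^ 'd \<Rightarrow> real) set" where
  "W2 T = {f \<in> C1_fun T. \<forall>x\<in>T. \<forall>y\<in>T. x \<noteq> y \<longrightarrow>
     (\<lambda>t. f (x + (t / norm (y - x)) *\<^sub>R (y - x))) \<in> W2inf 0 (norm (y - x))}"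

text \<open>
  Information vectors \<open>(y\<^sub>0, \<dots>, y\<^sub>d, z\<^sub>0, \<dots>, z\<^sub>d)\<close>; for \<open>CARD('i) = d + 1\<close> this space has dimension
  \<open>(d + 1) + (d + 1) d = (d + 1)\<^sup>2\<close>.
\<close>

type_synonym ('i, 'd) info = "(real, 'i) vec \<times> ((real, 'd) vec, 'i) vec"

definition info :: "('i::finite \<Rightarrow> real ^ 'd) \<Rightarrow> (real ^ 'd \<Rightarrow> real) \<Rightarrow> ('i, 'd::finite) info" where
  "info v f = ((\<chi> i. f (v i)), (\<chi> i. grad_within (simplex_hull v) f (v i)))"

text \<open>The worst-case errors may be infinite and are therefore extended reals.\<close>

definition point_error ::
  "('i::finite \<Rightarrow> real ^ 'd) \<Rightarrow> real ^ 'd \<Rightarrow> (('i, 'd::finite) info \<Rightarrow> real) \<Rightarrow> ereal" where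
  "point_error v w \<Psi> = (SUP f\<in>W2 (simplex_hull v). ereal \<bar>f w - \<Psi> (info v f)\<bar>)"

definition optimal_point_error :: "('i::finite \<Rightarrow> real ^ 'd) \<Rightarrow> real ^ 'd \<Rightarrow> ereal" where
  "optimal_point_error v w = (INF \<Psi>. point_error v w \<Psi>)"

definition seminorm_cont :: "(real ^ 'd) set \<Rightarrow> ((real ^ 'd \<Rightarrow> real) \<Rightarrow> real) \<Rightarrow> bool" where
  "seminorm_cont T N \<longleftrightarrow>
     (\<forall>f\<in>cont_fun T. \<forall>g\<in>cont_fun T. (\<forall>x\<in>T. f x = g x) \<longrightarrow> N f = N g) \<and>
     (\<forall>f\<in>cont_fun T. N f \<ge> 0) \<and>
     (\<forall>f\<in>cont_fun T. \<forall>a. N (\<lambda>x. a * f x) = \<bar>a\<bar> * N f) \<and>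
     (\<forall>f\<in>cont_fun T. \<forall>g\<in>cont_fun T. N (\<lambda>x. f x + g x) \<le> N f + N g)"

definition monotone_seminorm :: "(real ^ 'd) set \<Rightarrow> ((real ^ 'd \<Rightarrow> real) \<Rightarrow> real) \<Rightarrow> bool" where
  "monotone_seminorm T N \<longleftrightarrow> seminorm_cont T N \<and>
     (\<forall>f\<in>cont_fun T. \<forall>g\<in>cont_fun T. (\<forall>x\<in>T. \<bar>f x\<bar> \<le> \<bar>g x\<bar>) \<longrightarrow> N f \<le> N g)"

definition global_error ::
  "('i::finite \<Rightarrow> real ^ 'd) \<Rightarrow> ((real ^ 'd \<Rightarrow> real) \<Rightarrow> real) \<Rightarrow>
     (('i, 'd::finite) info \<Rightarrow> real ^ 'd \<Rightarrow> real) \<Rightarrow> ereal" where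
  "global_error v N \<Phi> = (SUP f\<in>W2 (simplex_hull v). ereal (N (\<lambda>x. f x - \<Phi> (info v f) x)))"

definition optimal_global_error ::
  "('i::finite \<Rightarrow> real ^ 'd) \<Rightarrow> ((real ^ 'd \<Rightarrow> real) \<Rightarrow> real) \<Rightarrow> ereal" where
  "optimal_global_error v N =
     (INF \<Phi>\<in>{\<Phi>. range \<Phi> \<subseteq> cont_fun (simplex_hull v)}. global_error v N \<Phi>)"

definition recovery ::
  "('i::finite \<Rightarrow> real ^ 'd) \<Rightarrow> (real ^ 'd \<Rightarrow> real) \<Rightarrow> real ^ 'd \<Rightarrow> real" where
  "recovery v f w = (\<Sum>i\<in>UNIV. barycentric (half_vertex v) (proj_half v w) i *
     (f (v i) + grad_within (simplex_hull v) f (v i) \<bullet>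
        (w - proj_half v w + (1/2) *\<^sub>R (circumcenter (range v) - v i))))"

definition Psi_star ::
  "('i::finite \<Rightarrow> real ^ 'd) \<Rightarrow> real ^ 'd \<Rightarrow> ('i, 'd::finite) info \<Rightarrow> real" where
  "Psi_star v w = (\<lambda>(y, z). \<Sum>i\<in>UNIV. barycentric (half_vertex v) (proj_half v w) i *
     (y $ i + z $ i \<bullet> (w - proj_half v w + (1/2) *\<^sub>R (circumcenter (range v) - v i))))"

definition Phi_star ::
  "('i::finite \<Rightarrow> real ^ 'd) \<Rightarrow> ('i, 'd::finite) info \<Rightarrow> real ^ 'd \<Rightarrow> real" where
  "Phi_star v yz = (\<lambda>w. Psi_star v w yz)"

definition err_fun :: "('i::finite \<Rightarrow> real ^ 'd) \<Rightarrow> real ^ 'd \<Rightarrow> real" where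
  "err_fun v w = (circumradius (range v))\<^sup>2 / 4 + (norm (w - proj_half v w))\<^sup>2
     - (1/2) * (norm (w - circumcenter (range v)))\<^sup>2"

end

theory Submission
  imports Defs
begin

text \<open>
  Let \<open>b\<^sub>i\<close> be the barycentric coordinates of \<open>\<phi>(w)\<close> in \<open>U\<close> and \<open>x\<^sub>i = w - \<phi>(w) + u\<^sub>i\<close>, so that
  \<open>\<Sum> b\<^sub>i x\<^sub>i = w\<close>. Adding, with weights \<open>b\<^sub>i\<close>, the Taylor estimates of \<open>f\<close> from \<open>v\<^sub>i\<close> to \<open>x\<^sub>i\<close> and from
  \<open>w\<close> to \<open>x\<^sub>i\<close> eliminates the gradient of \<open>f\<close> at \<open>w\<close> and bounds \<open>\<bar>f(w) - p\<^sub>f(w)\<bar>\<close> by the error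
  function. This needs \<open>x\<^sub>i \<in> T\<close>, which follows from \<open>c + 2(w - \<phi>(w)) \<in> T\<close>: that point lies in the
  Voronoi cell of every vertex \<open>v\<^sub>i\<close> with \<open>b\<^sub>i > 0\<close> and on the inner side of the facets opposite to
  the other vertices, which for a completely well-centered simplex forces it into \<open>T\<close>.
  Conversely, the error function and its negative belong to the class, because its gradient
  \<open>w + c - 2\<phi>(w)\<close> is, up to sign and translation, the reflection \<open>2\<phi> - id\<close> at a convex
  set and hence nonexpansive;
  both have zero information, so that no method can do better.
\<close>

section \<open>Barycentric coordinates and circumcenters\<close>

text \<open>Weights indexed by the whole index type and vanishing off \<open>K\<close> let points of
  different faces be compared through sums over \<open>UNIV\<close>. Injectivity of \<open>p\<close>
  turns weights on points into weights on indices.\<close>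

lemma convex_hull_image_weights:
  fixes p :: "'i::finite \<Rightarrow> 'a::real_vector"
  assumes "inj_on p K" and "x \<in> convex hull (p ` K)"
  shows "\<exists>a. (\<forall>i. 0 \<le> a i) \<and> (\<forall>i. i \<notin> K \<longrightarrow> a i = 0) \<and>
    (\<Sum>i\<in>UNIV. a i) = 1 \<and> x = (\<Sum>i\<in>UNIV. a i *\<^sub>R p i)"
proof -
  obtain a where a: "\<And>y. y \<in> p ` K \<Longrightarrow> 0 \<le> a y" "sum a (p ` K) = 1"
    "(\<Sum>y\<in>p ` K. a y *\<^sub>R y) = x"
    using assms(2) by (auto simp: convex_hull_finite)
  let ?a = "\<lambda>i. if i \<in> K then a (p i) else 0"
  have "(\<Sum>i\<in>UNIV. ?a i) = (\<Sum>i\<in>K. a (p i))"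
    by (simp add: sum.If_cases)
  then have "(\<Sum>i\<in>UNIV. ?a i) = 1"
    using a(2) assms(1) by (simp add: sum.reindex)
  moreover have "(\<Sum>i\<in>UNIV. ?a i *\<^sub>R p i) = (\<Sum>i\<in>K. a (p i) *\<^sub>R p i)"
    by (simp add: if_distrib[of "\<lambda>r. r *\<^sub>R _"] sum.If_cases cong: if_cong)
  then have "x = (\<Sum>i\<in>UNIV. ?a i *\<^sub>R p i)"
    using a(3) assms(1) by (simp add: sum.reindex)
  ultimately show ?thesis
    using a(1) by (intro exI[of _ ?a]) auto
qed

text \<open>The variational inequality at the nearest point holds for \<open>x\<close> and, in an
  affine set, also for the mirror image of \<open>x\<close> in that point; together they force
  equality.\<close>

lemma closest_point_affine_orthogonal:
  fixes A :: "'a::euclidean_space set"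
  assumes "affine A" and "x \<in> A"
  shows "(p - closest_point A p) \<bullet> (x - closest_point A p) = 0"
proof -
  let ?y = "closest_point A p"
  have cl: "closed A" "convex A"
    using assms(1) affine_imp_convex affine_closed by auto
  have y: "?y \<in> A"
    using cl assms(2) closest_point_in_set by blast
  have "2 *\<^sub>R ?y + (-1) *\<^sub>R x \<in> A"
    using assms y by (intro mem_affine) auto
  then have "(p - ?y) \<bullet> ((2 *\<^sub>R ?y + (-1) *\<^sub>R x) - ?y) \<le> 0"
    by (rule closest_point_dot[OF cl(2,1)])
  then have "(p - ?y) \<bullet> (x - ?y) \<ge> 0"
    by (simp add: inner_diff_right inner_add_right)
  then show ?thesis
    using closest_point_dot[OF cl(2,1) assms(2), of p] by simp
qed

text \<open>The bisector of two points equidistant from \<open>c\<close> passes through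
  \<open>c\<close>, so comparing distances to them is a linear inequality in \<open>z - c\<close>.
  Voronoi conditions thereby become cone conditions.\<close>

lemma dist_le_iff_inner_le:
  fixes c x y z :: "'a::real_inner"
  assumes "dist c x = dist c y"
  shows "dist z x \<le> dist z y \<longleftrightarrow> (z - c) \<bullet> (y - x) \<le> 0"
proof -
  have "(dist c x)\<^sup>2 = (dist c y)\<^sup>2"
    using assms by simp
  then have "(dist z y)\<^sup>2 - (dist z x)\<^sup>2 = - 2 * ((z - c) \<bullet> (y - x))"
    by (simp add: dist_norm power2_norm_eq_inner inner_diff inner_commute)
  moreover have "dist z x \<le> dist z y \<longleftrightarrow> (dist z x)\<^sup>2 \<le> (dist z y)\<^sup>2"
    by (simp add: abs_le_square_iff[symmetric])
  ultimately show ?thesis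
    by linarith
qed

text \<open>Both definite descriptions are proper here. Existence: the projection of the equidistant
  point \<open>p\<close> to the affine hull stays equidistant by Pythagoras. Uniqueness: the
  difference of two candidates is a direction of the affine hull and orthogonal to all such
  directions.\<close>

lemma dist_circumcenter_eq_circumradius:
  fixes V :: "(real ^ 'd::finite) set"
  assumes p: "\<And>x. x \<in> V \<Longrightarrow> dist p x = s" and a: "a \<in> V"
  shows "dist (circumcenter V) a = circumradius V"
proof -
  let ?A = "affine hull V"
  define y where "y = closest_point ?A p"
  have y: "y \<in> ?A"
    using a unfolding y_def
    by (intro closest_point_in_set) (auto simp: closed_affine_hull)
  have yx: "dist y x = dist y a" if "x \<in> V" for x
  proof -
    have pyth: "(dist y z)\<^sup>2 = s\<^sup>2 - (norm (p - y))\<^sup>2" if "z \<in> V" for z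
    proof -
      have "(p - y) \<bullet> (z - y) = 0"
        using that unfolding y_def
        by (intro closest_point_affine_orthogonal affine_affine_hull hull_inc)
      then have "(dist p z)\<^sup>2 = (norm (p - y))\<^sup>2 + (dist y z)\<^sup>2"
        by (simp add: dist_norm power2_norm_eq_inner algebra_simps inner_commute)
      then show ?thesis
        using p[OF that] by simp
    qed
    have "(dist y x)\<^sup>2 = (dist y a)\<^sup>2"
      using pyth[OF that] pyth[OF a] by simp
    then show ?thesis
      by simp
  qed
  have "\<exists>!c. c \<in> ?A \<and> (\<exists>r. \<forall>x\<in>V. dist c x = r)"
  proof (rule ex1I[of _ y])
    show "y \<in> ?A \<and> (\<exists>r. \<forall>x\<in>V. dist y x = r)"
      using y yx by (intro conjI exI[of _ "dist y a"] ballI) auto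
    fix c assume c: "c \<in> ?A \<and> (\<exists>r. \<forall>x\<in>V. dist c x = r)"
    then obtain r where r: "\<And>x. x \<in> V \<Longrightarrow> dist c x = r"
      by blast
    have "V \<subseteq> {x. (c - y) \<bullet> x = (c - y) \<bullet> a}"
    proof
      fix x assume "x \<in> V"
      then have "(c - y) \<bullet> (x - a) = 0"
        using r[of x] r[OF a] yx[of x]
          dist_le_iff_inner_le[of y x a c] dist_le_iff_inner_le[of y a x c]
        by (simp add: inner_diff_right)
      then show "x \<in> {x. (c - y) \<bullet> x = (c - y) \<bullet> a}"
        by (simp add: inner_diff_right)
    qed
    then have "?A \<subseteq> {x. (c - y) \<bullet> x = (c - y) \<bullet> a}"
      by (intro hull_minimal affine_hyperplane)
    then have "(c - y) \<bullet> c = (c - y) \<bullet> a" "(c - y) \<bullet> y = (c - y) \<bullet> a"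
      using c y by auto
    then have "(c - y) \<bullet> (c - y) = 0"
      by (simp add: inner_diff_right)
    then show "c = y"
      by simp
  qed
  then have "circumcenter V \<in> ?A \<and> (\<exists>r. \<forall>x\<in>V. dist (circumcenter V) x = r)"
    unfolding circumcenter_def by (rule theI')
  then obtain r where r: "\<forall>x\<in>V. dist (circumcenter V) x = r"
    by blast
  have "circumradius V = r"
    unfolding circumradius_def using r a by (intro the_equality) auto
  then show ?thesis
    using r a by simp
qed

section \<open>Affine coordinates with respect to the vertices\<close>

locale nondegenerate =
  fixes v :: "'i::finite \<Rightarrow> real ^ 'd::finite"
  assumes card_index: "CARD('i) = CARD('d) + 1"
    and nondegenerate_simplex: "nondegenerate_simplex v"
begin

text \<open>The map \<open>L\<close> from weights to (weighted sum, total weight) is onto, because a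
  normal \<open>(a, s)\<close> of its range would put the simplex into a hyperplane. The cardinality
  assumption equates the dimensions, so \<open>L\<close> is bijective and \<open>g\<close> is its
  inverse.\<close>

lemma ex_coordinates:
  "\<exists>g :: (real ^ 'd) \<times> real \<Rightarrow> real ^ 'i. linear g \<and>
     (\<forall>y. g (\<Sum>i\<in>UNIV. y $ i *\<^sub>R v i, \<Sum>i\<in>UNIV. y $ i) = y) \<and>
     (\<forall>z. (\<Sum>i\<in>UNIV. g z $ i *\<^sub>R v i, \<Sum>i\<in>UNIV. g z $ i) = z)"
proof -
  define L :: "real ^ 'i \<Rightarrow> (real ^ 'd) \<times> real"
    where "L y = (\<Sum>i\<in>UNIV. y $ i *\<^sub>R v i, \<Sum>i\<in>UNIV. y $ i)" for y
  have lin: "linear L"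
    by (rule linearI)
      (auto simp: L_def scaleR_left_distrib sum.distrib scaleR_right.sum sum_distrib_left)
  have L_axis: "L (axis i 1) = (v i, 1)" for i
  proof -
    have "(\<Sum>j\<in>UNIV. axis i (1::real) $ j *\<^sub>R v j) = (\<Sum>j\<in>UNIV. if j = i then v j else 0)"
      by (intro sum.cong) (auto simp: axis_def)
    moreover have "(\<Sum>j\<in>UNIV. axis i (1::real) $ j) = (\<Sum>j\<in>UNIV. if j = i then 1 else 0)"
      by (intro sum.cong) (auto simp: axis_def)
    ultimately show ?thesis
      by (simp add: L_def)
  qed
  have "surj L"
  proof (rule ccontr)
    assume "\<not> surj L"
    moreover have "subspace (range L)"
      using lin by (intro linear_subspace_image) auto
    ultimately have "span (range L) \<noteq> UNIV"
      by (simp add: span_eq_iff[THEN iffD2])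
    then obtain n where n: "n \<noteq> 0" "span (range L) \<subseteq> {z. n \<bullet> z = 0}"
      using span_not_univ_subset_hyperplane by blast
    obtain a s where as: "n = (a, s)"
      by (cases n)
    have eq: "a \<bullet> v i = - s" for i
    proof -
      have "L (axis i 1) \<in> span (range L)"
        by (intro span_base) auto
      then have "n \<bullet> (v i, 1) = 0"
        using n(2) L_axis by auto
      then show ?thesis
        by (simp add: as)
    qed
    have "a \<noteq> 0"
      using eq n(1) as by (auto simp: zero_prod_def)
    moreover have "simplex_hull v \<subseteq> {x. a \<bullet> x = - s}"
      using eq by (intro hull_minimal convex_hyperplane) auto
    ultimately show False
      using nondegenerate_simplex unfolding nondegenerate_simplex_def by blast
  qed
  moreover have "DIM(real ^ 'i) = DIM((real ^ 'd) \<times> real)"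
    using card_index by simp
  ultimately have "inj L"
    using lin linear_surjective_imp_injective[of L]
    by (metis eucl.dim_UNIV dim_UNIV)
  obtain g where g: "linear g" "g \<circ> L = id"
    using linear_injective_left_inverse[OF lin \<open>inj L\<close>] by blast
  have gL: "g (L y) = y" for y
    using g(2) by (metis comp_apply id_apply)
  have "L (g z) = z" for z
    using \<open>surj L\<close> gL by (metis surjD)
  with g(1) gL show ?thesis
    unfolding L_def by blast
qed

text \<open>Signed barycentric coordinates, meaningful on the whole space, whereas
  \<open>barycentric\<close> asks for nonnegative weights. The second entry 1 prescribes the total
  weight.\<close>

definition coord :: "real ^ 'd \<Rightarrow> 'i \<Rightarrow> real" where
  "coord x i = (SOME g. linear g \<and>
     (\<forall>y. g (\<Sum>i\<in>UNIV. y $ i *\<^sub>R v i, \<Sum>i\<in>UNIV. y $ i) = y) \<and>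
     (\<forall>z. (\<Sum>i\<in>UNIV. g z $ i *\<^sub>R v i, \<Sum>i\<in>UNIV. g z $ i) = z)) (x, 1) $ i"

lemma
  shows sum_coord: "(\<Sum>i\<in>UNIV. coord x i) = 1"
    and sum_coord_scaleR: "(\<Sum>i\<in>UNIV. coord x i *\<^sub>R v i) = x"
    and coord_unique: "(\<Sum>i\<in>UNIV. a i) = 1 \<Longrightarrow> coord (\<Sum>i\<in>UNIV. a i *\<^sub>R v i) = a"
    and coord_affine: "\<exists>p s. \<forall>x. coord x i = p \<bullet> x + s"
proof -
  obtain g :: "(real ^ 'd) \<times> real \<Rightarrow> real ^ 'i" where g: "linear g"
     "\<And>y. g (\<Sum>i\<in>UNIV. y $ i *\<^sub>R v i, \<Sum>i\<in>UNIV. y $ i) = y"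
     "\<And>z. (\<Sum>i\<in>UNIV. g z $ i *\<^sub>R v i, \<Sum>i\<in>UNIV. g z $ i) = z"
    and c: "\<And>x i. coord x i = g (x, 1) $ i"
    using someI_ex[OF ex_coordinates] unfolding coord_def by metis
  show "(\<Sum>i\<in>UNIV. coord x i) = 1" "(\<Sum>i\<in>UNIV. coord x i *\<^sub>R v i) = x"
    using g(3)[of "(x, 1)"] by (simp_all add: c)
  show "coord (\<Sum>i\<in>UNIV. a i *\<^sub>R v i) = a" if "(\<Sum>i\<in>UNIV. a i) = 1"
    using g(2)[of "\<chi> i. a i"] that by (auto simp: c)
  have "linear (\<lambda>z. g z $ i)"
    by (rule linearI) (simp_all add: linear_add[OF g(1)] linear_cmul[OF g(1)])
  \<comment> \<open>Riesz representation: a linear functional is the inner product with the image of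
    1 under its adjoint.\<close>
  then have adj: "z \<bullet> adjoint (\<lambda>z. g z $ i) 1 = g z $ i" for z
    by (simp add: adjoint_works)
  define q where "q = adjoint (\<lambda>z. g z $ i) 1"
  have q: "g z $ i = z \<bullet> q" for z
    unfolding q_def by (rule adj[symmetric])
  have "coord x i = fst q \<bullet> x + snd q" for x
    by (simp add: c q inner_prod_def inner_commute)
  then show "\<exists>p s. \<forall>x. coord x i = p \<bullet> x + s"
    by blast
qed

lemma coord_vertex: "coord (v j) i = (if i = j then 1 else 0)"
proof -
  have "(\<Sum>i\<in>UNIV. (if i = j then 1 else 0) *\<^sub>R v i) = v j"
    by (simp add: if_distrib[of "\<lambda>r. r *\<^sub>R _"] cong: if_cong)
  then show ?thesis
    using coord_unique[of "\<lambda>i. if i = j then 1 else 0"] by simp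
qed

lemma inj_vertex: "inj v"
  by (rule injI) (metis coord_vertex zero_neq_one)

lemma continuous_coord: "continuous_on S (\<lambda>x. coord x i)"
proof -
  obtain p s where "\<forall>x. coord x i = p \<bullet> x + s"
    using coord_affine by blast
  then show ?thesis
    by (simp add: continuous_on_add continuous_on_inner)
qed

lemma coord_nonneg:
  assumes "x \<in> simplex_hull v"
  shows "0 \<le> coord x i"
proof -
  obtain a where a: "\<forall>i. 0 \<le> a i"
      "(\<Sum>i\<in>UNIV. a i) = 1" "x = (\<Sum>i\<in>UNIV. a i *\<^sub>R v i)"
    using convex_hull_image_weights[OF inj_vertex assms] by blast
  have "coord x = a"
    unfolding a(3) by (rule coord_unique[OF a(2)])
  then show ?thesis
    using a(1) by simp
qed

text \<open>An affine function can be prescribed at the vertices. If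
  \<open>p \<bullet> x + s\<close> equals half the squared norm there, then the squared distance
  from \<open>p\<close> to \<open>v j\<close> collapses to \<open>(norm p)^2 + 2 * s\<close>, which
  is independent of \<open>j\<close>.\<close>

lemma ex_equidistant: "\<exists>p s. \<forall>i. dist p (v i) = s"
proof -
  obtain P S where PS: "\<And>i x. coord x i = P i \<bullet> x + S i"
    using coord_affine by metis
  define p where "p = (\<Sum>i\<in>UNIV. ((norm (v i))\<^sup>2 / 2) *\<^sub>R P i)"
  define s where "s = (\<Sum>i\<in>UNIV. (norm (v i))\<^sup>2 / 2 * S i)"
  have half: "p \<bullet> v j + s = (norm (v j))\<^sup>2 / 2" for j
  proof -
    have "p \<bullet> v j + s = (\<Sum>i\<in>UNIV. (norm (v i))\<^sup>2 / 2 * coord (v j) i)"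
      by (simp add: p_def s_def PS inner_sum_left sum.distrib distrib_left)
    also have "\<dots> = (\<Sum>i\<in>UNIV. if i = j then (norm (v i))\<^sup>2 / 2 else 0)"
      by (intro sum.cong) (auto simp: coord_vertex)
    finally show ?thesis
      by simp
  qed
  have "(norm (v j))\<^sup>2 = 2 * (p \<bullet> v j) + 2 * s" for j
    using half[of j] by linarith
  then have "(dist p (v j))\<^sup>2 = (norm p)\<^sup>2 + 2 * s" for j
    by (simp add: dist_norm power2_norm_eq_inner inner_diff inner_commute)
  then have "dist p (v j) = sqrt ((norm p)\<^sup>2 + 2 * s)" for j
    by (metis real_sqrt_unique zero_le_dist)
  then show ?thesis
    by blast
qed

lemma dist_circumcenter:
  assumes "i \<in> K"
  shows "dist (circumcenter (v ` K)) (v i) = circumradius (v ` K)"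
proof -
  obtain p s where "\<forall>i. dist p (v i) = s"
    using ex_equidistant by blast
  then show ?thesis
    using assms by (intro dist_circumcenter_eq_circumradius[of _ p s]) auto
qed

section \<open>The half-size simplex and its nearest-point map\<close>

abbreviation "T \<equiv> simplex_hull v"
abbreviation "ctr \<equiv> circumcenter (range v)"
abbreviation "rad \<equiv> circumradius (range v)"
abbreviation "u \<equiv> half_vertex v"
abbreviation "U \<equiv> simplex_hull u"
abbreviation "\<phi> \<equiv> proj_half v"

text \<open>The map sending \<open>x\<close> to the midpoint of \<open>ctr\<close> and
  \<open>x\<close> carries \<open>T\<close> onto \<open>U\<close>, so coordinates relative to
  \<open>U\<close> are \<open>coord\<close> at the preimage \<open>2 \<phi> w - ctr\<close>.\<close>

definition half_coord :: "real ^ 'd \<Rightarrow> 'i \<Rightarrow> real" where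
  "half_coord w = coord (2 *\<^sub>R \<phi> w - ctr)"

lemma norm_vertex_diff: "norm (v i - ctr) = rad"
  using dist_circumcenter[of i UNIV] by (simp add: dist_norm norm_minus_commute)

lemma half_vertex_diff: "u i - ctr = (1/2) *\<^sub>R (v i - ctr)"
  by (simp add: half_vertex_def algebra_simps flip: scaleR_2)

lemma vertex_minus_half_vertex: "v i - u i = (1/2) *\<^sub>R (v i - ctr)"
  by (simp add: half_vertex_def algebra_simps flip: scaleR_2)

lemma sum_half_vertex:
  assumes "(\<Sum>i\<in>UNIV. a i) = 1"
  shows "(\<Sum>i\<in>UNIV. a i *\<^sub>R u i) = (1/2) *\<^sub>R (ctr + (\<Sum>i\<in>UNIV. a i *\<^sub>R v i))"
proof -
  have "(\<Sum>i\<in>UNIV. a i *\<^sub>R u i) =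
      (\<Sum>i\<in>UNIV. (1/2) *\<^sub>R (a i *\<^sub>R ctr) + (1/2) *\<^sub>R (a i *\<^sub>R v i))"
    by (intro sum.cong) (auto simp: half_vertex_def algebra_simps)
  also have "\<dots> = (1/2) *\<^sub>R ((\<Sum>i\<in>UNIV. a i) *\<^sub>R ctr + (\<Sum>i\<in>UNIV. a i *\<^sub>R v i))"
    by (simp add: sum.distrib scaleR_right.sum scaleR_left.sum scaleR_right_distrib)
  finally show ?thesis
    using assms by simp
qed

lemma closed_half: "closed U"
  by (intro compact_imp_closed finite_imp_compact_convex_hull) auto

lemma half_nonempty: "U \<noteq> {}"
  by simp

lemma proj_half_in: "\<phi> w \<in> U"
  unfolding proj_half_def by (intro closest_point_in_set closed_half half_nonempty)

lemma proj_half_dot: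
  assumes "x \<in> U"
  shows "(w - \<phi> w) \<bullet> (x - \<phi> w) \<le> 0"
  unfolding proj_half_def by (intro closest_point_dot closed_half assms convex_convex_hull)

lemma half_vertex_in: "u i \<in> U"
  by (simp add: hull_inc)

lemma inj_half_vertex: "inj u"
  using inj_vertex by (simp add: inj_def half_vertex_def)

lemma
  shows sum_half_coord: "(\<Sum>i\<in>UNIV. half_coord w i) = 1"
    and sum_half_coord_scaleR: "(\<Sum>i\<in>UNIV. half_coord w i *\<^sub>R u i) = \<phi> w"
    and half_coord_nonneg: "0 \<le> half_coord w i"
    and barycentric_half: "barycentric u (\<phi> w) = half_coord w"
proof -
  show s1: "(\<Sum>i\<in>UNIV. half_coord w i) = 1"
    unfolding half_coord_def by (rule sum_coord)
  show s2: "(\<Sum>i\<in>UNIV. half_coord w i *\<^sub>R u i) = \<phi> w"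
    using sum_half_vertex[OF s1] by (simp add: half_coord_def sum_coord_scaleR)
  \<comment> \<open>Uniqueness holds even among signed weights. Hence the nonnegative weights
    supplied by membership in \<open>U\<close> are the values of
    \<open>half_coord w\<close>.\<close>
  have unique: "a = half_coord w"
    if a: "(\<Sum>i\<in>UNIV. a i) = 1" "\<phi> w = (\<Sum>i\<in>UNIV. a i *\<^sub>R u i)" for a
  proof -
    have "2 *\<^sub>R \<phi> w - ctr = (\<Sum>i\<in>UNIV. a i *\<^sub>R v i)"
      unfolding a(2) sum_half_vertex[OF a(1)] by simp
    then show ?thesis
      using coord_unique[OF a(1)] by (simp add: half_coord_def)
  qed
  have "\<exists>a. (\<forall>i. 0 \<le> a i) \<and> (\<forall>i. i \<notin> UNIV \<longrightarrow> a i = 0) \<and>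
    (\<Sum>i\<in>UNIV. a i) = 1 \<and> \<phi> w = (\<Sum>i\<in>UNIV. a i *\<^sub>R u i)"
    by (rule convex_hull_image_weights[OF inj_half_vertex proj_half_in])
  then have nonneg: "\<forall>i. 0 \<le> half_coord w i"
    using unique by metis
  then show "0 \<le> half_coord w i"
    by blast
  show "barycentric u (\<phi> w) = half_coord w"
    unfolding barycentric_def
  proof (rule the_equality)
    show "\<phi> w = (\<Sum>i\<in>UNIV. half_coord w i *\<^sub>R u i) \<and> (\<Sum>i\<in>UNIV. half_coord w i) = 1 \<and>
        (\<forall>i. 0 \<le> half_coord w i)"
      using nonneg s1 s2 by simp
    show "a = half_coord w"
      if "\<phi> w = (\<Sum>i\<in>UNIV. a i *\<^sub>R u i) \<and> (\<Sum>i\<in>UNIV. a i) = 1 \<and> (\<forall>i. 0 \<le> a i)" for a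
      using that by (intro unique) blast+
  qed
qed

text \<open>Complementary slackness: the weighted terms are all nonpositive, and they sum to zero
  because \<open>\<phi> w\<close> is the weighted mean of the \<open>u k\<close>.\<close>

lemma proj_half_orthogonal:
  assumes "half_coord w i \<noteq> 0"
  shows "(w - \<phi> w) \<bullet> (u i - \<phi> w) = 0"
proof -
  have le: "half_coord w k * ((w - \<phi> w) \<bullet> (u k - \<phi> w)) \<le> 0" for k
    using proj_half_dot[OF half_vertex_in] half_coord_nonneg by (simp add: mult_nonneg_nonpos)
  have "(\<Sum>k\<in>UNIV. half_coord w k * ((w - \<phi> w) \<bullet> (u k - \<phi> w))) =
      (w - \<phi> w) \<bullet> ((\<Sum>k\<in>UNIV. half_coord w k *\<^sub>R u k) - (\<Sum>k\<in>UNIV. half_coord w k) *\<^sub>R \<phi> w)"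
    by (simp add: inner_diff_right inner_sum_right right_diff_distrib sum_subtractf sum_distrib_right)
  also have "\<dots> = 0"
    by (simp add: sum_half_coord sum_half_coord_scaleR)
  finally have "(\<Sum>k\<in>UNIV. - (half_coord w k * ((w - \<phi> w) \<bullet> (u k - \<phi> w)))) = 0"
    by (simp add: sum_negf)
  then have "half_coord w i * ((w - \<phi> w) \<bullet> (u i - \<phi> w)) = 0"
    using le by (subst (asm) sum_nonneg_eq_0_iff) auto
  then show ?thesis
    using assms by simp
qed

text \<open>Firm nonexpansiveness of the projection, as the sum of its variational inequalities at
  \<open>x\<close> and \<open>y\<close>. It is what keeps the reflection
  \<open>2 \<phi> - id\<close> from increasing distances.\<close>

lemma proj_half_nonexpansive:
  "((x - \<phi> x) - (y - \<phi> y)) \<bullet> (\<phi> x - \<phi> y) \<ge> 0"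
  using proj_half_dot[OF proj_half_in, of x y] proj_half_dot[OF proj_half_in, of y x]
  by (simp add: inner_diff inner_commute)

text \<open>All \<open>u k\<close> lie on the sphere of radius \<open>rad / 2\<close> about
  \<open>ctr\<close>. By Cauchy-Schwarz the half-space tangent at \<open>u i\<close> contains
  \<open>U\<close>, and \<open>v i - u i\<close> is an outer normal to it.\<close>

lemma proj_half_vertex: "\<phi> (v i) = u i"
proof -
  have "norm (v i - u i) \<le> norm (v i - x)" if "x \<in> U" for x
  proof -
    have "U \<subseteq> {x. (v i - ctr) \<bullet> x \<le> (v i - ctr) \<bullet> u i}"
    proof (intro hull_minimal convex_halfspace_le, clarsimp)
      fix k
      have "(v i - ctr) \<bullet> (v k - ctr) \<le> norm (v i - ctr) * norm (v k - ctr)"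
        by (rule norm_cauchy_schwarz)
      also have "\<dots> = (v i - ctr) \<bullet> (v i - ctr)"
        by (simp add: norm_vertex_diff power2_eq_square flip: power2_norm_eq_inner)
      finally have "(v i - ctr) \<bullet> (u k - ctr) \<le> (v i - ctr) \<bullet> (u i - ctr)"
        by (simp add: half_vertex_diff)
      then show "(v i - ctr) \<bullet> u k \<le> (v i - ctr) \<bullet> u i"
        by (simp add: inner_diff_right)
    qed
    then have "(v i - ctr) \<bullet> (x - u i) \<le> 0"
      using that by (auto simp: inner_diff_right)
    then have "(v i - u i) \<bullet> (x - u i) \<le> 0"
      by (simp add: vertex_minus_half_vertex)
    then have "(norm (v i - u i))\<^sup>2 \<le> (norm (v i - x))\<^sup>2 "
      using inner_ge_zero[of "x - u i"]
      by (simp add: power2_norm_eq_inner inner_diff inner_commute)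
    then show ?thesis
      by (simp add: abs_le_square_iff[symmetric])
  qed
  then show ?thesis
    unfolding proj_half_def
    by (intro closest_point_unique[symmetric] closed_half half_vertex_in convex_convex_hull)
      (auto simp: dist_norm)
qed

lemma continuous_proj_half: "continuous_on S \<phi>"
  unfolding proj_half_def
  using continuous_on_closest_point[OF convex_convex_hull closed_half half_nonempty] .

lemma continuous_half_coord: "continuous_on S (\<lambda>w. half_coord w i)"
proof -
  have "continuous_on S (\<lambda>w. 2 *\<^sub>R \<phi> w - ctr)"
    by (intro continuous_intros continuous_proj_half)
  then show ?thesis
    unfolding half_coord_def
    by (rule continuous_on_compose2[OF continuous_coord[of UNIV]]) auto
qed

end

section \<open>Completely well-centered simplices\<close>

locale well_centered = nondegenerate v for v :: "'i::finite \<Rightarrow> real ^ 'd::finite" +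
  assumes completely_well_centered: "completely_well_centered v"
begin

text \<open>
  The points of the affine hull of a face that are equally close to the vertices in \<open>I\<close> and at
  least as close to them as to the other vertices form a cone with apex the circumcenter of the
  face. A ray from the apex inside this cone leaves the half-spaces of the vertices outside \<open>I\<close>
  through the hyperplane of a smaller face containing \<open>I\<close>, to which the induction hypothesis
  applies.
\<close>

lemma voronoi_face_subset:
  assumes "I \<noteq> {}" and "I \<subseteq> K"
    and "(\<Sum>i\<in>UNIV. b i) = 1"
    and "\<And>i. i \<notin> K \<Longrightarrow> b i = 0" and "\<And>i. i \<in> K - I \<Longrightarrow> 0 \<le> b i"
    and "\<And>i k. i \<in> I \<Longrightarrow> k \<in> K \<Longrightarrow>
      dist (\<Sum>i\<in>UNIV. b i *\<^sub>R v i) (v i) \<le> dist (\<Sum>i\<in>UNIV. b i *\<^sub>R v i) (v k)"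
  shows "(\<Sum>i\<in>UNIV. b i *\<^sub>R v i) \<in> convex hull (v ` K)"
  using assms
proof (induction "card (K - I)" arbitrary: K b rule: less_induct)
  case less
  define c where "c = circumcenter (v ` K)"
  define z where "z = (\<Sum>i\<in>UNIV. b i *\<^sub>R v i)"
  have c_in: "c \<in> convex hull (v ` K)"
  proof -
    have "v ` K \<subseteq> range v" "v ` K \<noteq> {}"
      using less.prems(1,2) by auto
    then show ?thesis
      using completely_well_centered unfolding completely_well_centered_def c_def by simp
  qed
  have "inj_on v K"
    using inj_vertex by (rule inj_on_subset) simp
  then obtain g where g: "\<forall>i. 0 \<le> g i" "\<forall>i. i \<notin> K \<longrightarrow> g i = 0" "(\<Sum>i\<in>UNIV. g i) = 1"
    "c = (\<Sum>i\<in>UNIV. g i *\<^sub>R v i)"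
    using convex_hull_image_weights[OF _ c_in] by metis
  have dc: "dist c (v i) = dist c (v k)" if "i \<in> K" "k \<in> K" for i k
    using that dist_circumcenter unfolding c_def by metis
  have cone: "(z - c) \<bullet> (v k - v i) \<le> 0" if "i \<in> I" "k \<in> K" for i k
  proof -
    have "dist z (v i) \<le> dist z (v k)"
      using less.prems(6) that unfolding z_def by blast
    then show ?thesis
      using dist_le_iff_inner_le[OF dc] that less.prems(2) by blast
  qed
  show ?case
  proof (cases "z = c")
    case True
    then show ?thesis
      using c_in z_def by simp
  next
    case False
    obtain i0 where i0: "i0 \<in> I"
      using less.prems(1) by blast
    \<comment> \<open>These are the coordinates outside \<open>I\<close> that decrease along the ray
      from \<open>c\<close> to \<open>z\<close>. If there were none, the cone condition would give
      \<open>z = c\<close>; this settles in particular the case \<open>K = I\<close>.\<close>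
    define M where "M = {j \<in> K - I. b j < g j}"
    have "M \<noteq> {}"
    proof
      assume "M = {}"
      then have ge: "g k \<le> b k" if "k \<in> K - I" for k
        using that unfolding M_def by force
      have "(z - c) \<bullet> (z - c) = (\<Sum>k\<in>UNIV. (b k - g k) * ((z - c) \<bullet> v k))"
        unfolding z_def g(4)
        by (simp add: left_diff_distrib sum_subtractf inner_diff_right inner_sum_right)
      \<comment> \<open>Both weight families sum to 1, so the subtracted term is zero; it turns each
        \<open>v k\<close> into the difference \<open>v k - v i0\<close> that the cone condition
        speaks of.\<close>
      also have "\<dots> = (\<Sum>k\<in>UNIV. (b k - g k) * ((z - c) \<bullet> v k)) -
          (\<Sum>k\<in>UNIV. (b k - g k)) * ((z - c) \<bullet> v i0)"
        using less.prems(3) g(3) by (simp add: sum_subtractf)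
      also have "\<dots> = (\<Sum>k\<in>UNIV. (b k - g k) * ((z - c) \<bullet> (v k - v i0)))"
        unfolding sum_distrib_right sum_subtractf[symmetric]
        by (simp add: inner_diff_right right_diff_distrib)
      also have "\<dots> \<le> 0"
      proof (rule sum_nonpos)
        fix k
        consider "k \<notin> K" | "k \<in> I" | "k \<in> K - I"
          by blast
        then show "(b k - g k) * ((z - c) \<bullet> (v k - v i0)) \<le> 0"
        proof cases
          case 1
          then show ?thesis
            using less.prems(4) g(2) by simp
        next
          case 2
          have "(z - c) \<bullet> (v k - v i0) \<le> 0" "(z - c) \<bullet> (v i0 - v k) \<le> 0"
            using cone[OF i0, of k] cone[OF 2, of i0] 2 i0 less.prems(2) by auto
          then have "(z - c) \<bullet> (v k - v i0) = 0"
            by (simp add: inner_diff_right)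
          then show ?thesis
            by simp
        next
          case 3
          then show ?thesis
            using ge cone[OF i0, of k] by (simp add: mult_nonneg_nonpos)
        qed
      qed
      finally have "z - c = 0"
        by (metis inner_eq_zero_iff inner_ge_zero order_antisym)
      with False show False
        by simp
    qed
    \<comment> \<open>\<open>f j\<close> is the ray parameter at which coordinate \<open>j\<close>
      vanishes, and minimizing over \<open>M\<close> selects the first coordinate to do so.\<close>
    define f where "f j = g j / (g j - b j)" for j
    obtain j where "is_arg_min f (\<lambda>j. j \<in> M) j"
      using ex_is_arg_min_if_finite[of M f] \<open>M \<noteq> {}\<close> by auto
    then have j: "j \<in> M" "\<And>k. k \<in> M \<Longrightarrow> f j \<le> f k"
      by (auto simp: is_arg_min_linorder)
    define t where "t = f j"
    define b' where "b' k = g k + t * (b k - g k)" for k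
    have jM: "j \<in> K" "j \<notin> I" "b j < g j"
      using j(1) by (auto simp: M_def)
    \<comment> \<open>At \<open>z\<close>, the point with parameter 1, coordinate \<open>j\<close>
      is still nonnegative, so the ray does not leave before reaching \<open>z\<close>.\<close>
    have "0 \<le> b j"
      using less.prems(5) jM by blast
    then have t: "1 \<le> t"
      using jM by (simp add: t_def f_def)
    have b'_j: "b' j = 0"
      using jM by (simp add: b'_def t_def f_def field_simps)
    have sum_b': "(\<Sum>i\<in>UNIV. b' i) = 1"
      using less.prems(3) g(3)
      by (simp add: b'_def sum.distrib sum_subtractf flip: sum_distrib_left)
    have z': "(\<Sum>i\<in>UNIV. b' i *\<^sub>R v i) = c + t *\<^sub>R (z - c)"
      unfolding z_def g(4) b'_def
      by (simp add: scaleR_left_distrib scaleR_left_diff_distrib sum.distrib sum_subtractf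
          scaleR_right.sum scaleR_right_diff_distrib right_diff_distrib)
    have "(\<Sum>i\<in>UNIV. b' i *\<^sub>R v i) \<in> convex hull (v ` (K - {j}))"
    proof (rule less.hyps)
      have "K - {j} - I = (K - I) - {j}"
        by blast
      then show "card (K - {j} - I) < card (K - I)"
        using jM by (metis DiffI card_Diff1_less finite)
      show "I \<noteq> {}" "I \<subseteq> K - {j}"
        using less.prems(1,2) jM by auto
      show "(\<Sum>i\<in>UNIV. b' i) = 1"
        by (fact sum_b')
      show "b' i = 0" if "i \<notin> K - {j}" for i
        using that b'_j less.prems(4) g(2) by (cases "i = j") (auto simp: b'_def)
      show "0 \<le> b' i" if "i \<in> K - {j} - I" for i
      proof (cases "i \<in> M")
        case True
        then have pos: "b i < g i"
          by (simp add: M_def)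
        have "t \<le> g i / (g i - b i)"
          using j(2)[OF True] by (simp add: t_def f_def)
        then have "t * (g i - b i) \<le> g i"
          using pos by (simp add: pos_le_divide_eq)
        then show ?thesis
          by (simp add: b'_def algebra_simps)
      next
        case False
        then have "g i \<le> b i"
          using that by (auto simp: M_def)
        then show ?thesis
          using g(1) t by (simp add: b'_def)
      qed
      show "dist (\<Sum>i\<in>UNIV. b' i *\<^sub>R v i) (v i) \<le> dist (\<Sum>i\<in>UNIV. b' i *\<^sub>R v i) (v k)"
        if "i \<in> I" "k \<in> K - {j}" for i k
      proof -
        have "dist c (v i) = dist c (v k)"
          using that less.prems(2) by (intro dc) auto
        moreover have "t * ((z - c) \<bullet> (v k - v i)) \<le> 0"
          using cone[of i k] that t by (simp add: mult_nonneg_nonpos)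
        ultimately show ?thesis
          unfolding z' by (subst dist_le_iff_inner_le[of c]) auto
      qed
    qed
    then have "c + t *\<^sub>R (z - c) \<in> convex hull (v ` K)"
      unfolding z' by (meson Diff_subset hull_mono image_mono subsetD)
    \<comment> \<open>As \<open>t\<close> is at least 1, \<open>z\<close> lies on the segment from
      \<open>c\<close> to the exit point, and both ends are in the hull.\<close>
    then have "(1 - 1 / t) *\<^sub>R c + (1 / t) *\<^sub>R (c + t *\<^sub>R (z - c)) \<in> convex hull (v ` K)"
      using t c_in by (intro convexD[OF convex_convex_hull]) auto
    moreover have "(1 - 1 / t) *\<^sub>R c + (1 / t) *\<^sub>R (c + t *\<^sub>R (z - c)) = z"
      using t by (simp add: algebra_simps)
    ultimately show ?thesis
      by (simp add: z_def)
  qed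
qed

text \<open>Written as \<open>2 w - (2 \<phi> w - ctr)\<close>, the point has the signed coordinates
  \<open>2 * coord w i - half_coord w i\<close>. They are nonnegative where
  \<open>half_coord w i\<close> vanishes; for the other indices the variational inequality of the
  projection, with equality at \<open>u i\<close>, yields the Voronoi condition. So
  \<open>voronoi_face_subset\<close> applies to the full vertex set.\<close>

lemma circumcenter_add_normal_in:
  assumes "w \<in> T"
  shows "ctr + 2 *\<^sub>R (w - \<phi> w) \<in> T"
proof -
  define b where "b i = 2 * coord w i - half_coord w i" for i
  define I where "I = {i. half_coord w i \<noteq> 0}"
  have sum_b: "(\<Sum>i\<in>UNIV. b i) = 1"
    by (simp add: b_def sum_subtractf sum_coord sum_half_coord flip: sum_distrib_left)
  have "(\<Sum>i\<in>UNIV. half_coord w i *\<^sub>R v i) = 2 *\<^sub>R \<phi> w - ctr"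
    by (simp add: half_coord_def sum_coord_scaleR)
  moreover have "(\<Sum>i\<in>UNIV. b i *\<^sub>R v i) =
      2 *\<^sub>R (\<Sum>i\<in>UNIV. coord w i *\<^sub>R v i) - (\<Sum>i\<in>UNIV. half_coord w i *\<^sub>R v i)"
    by (simp add: b_def scaleR_left_diff_distrib sum_subtractf scaleR_right.sum)
  ultimately have "(\<Sum>i\<in>UNIV. b i *\<^sub>R v i) = 2 *\<^sub>R w - (2 *\<^sub>R \<phi> w - ctr)"
    by (simp add: sum_coord_scaleR)
  then have z: "(\<Sum>i\<in>UNIV. b i *\<^sub>R v i) = ctr + 2 *\<^sub>R (w - \<phi> w)"
    by (simp add: algebra_simps)
  have "(\<Sum>i\<in>UNIV. b i *\<^sub>R v i) \<in> convex hull (v ` UNIV)"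
  proof (rule voronoi_face_subset[of I])
    show "I \<noteq> {}"
      using sum_half_coord[of w] unfolding I_def by force
    show "0 \<le> b i" if "i \<in> UNIV - I" for i
      using that coord_nonneg[OF assms] by (simp add: b_def I_def)
    show "dist (\<Sum>i\<in>UNIV. b i *\<^sub>R v i) (v i) \<le> dist (\<Sum>i\<in>UNIV. b i *\<^sub>R v i) (v k)"
      if "i \<in> I" for i k
    proof -
      have "(w - \<phi> w) \<bullet> (u k - \<phi> w) \<le> 0" "(w - \<phi> w) \<bullet> (u i - \<phi> w) = 0"
        using proj_half_dot[OF half_vertex_in] proj_half_orthogonal that by (auto simp: I_def)
      then have "(w - \<phi> w) \<bullet> ((u k - ctr) - (u i - ctr)) \<le> 0"
        by (simp add: inner_diff_right)
      then have "(w - \<phi> w) \<bullet> (v k - v i) \<le> 0"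
        unfolding half_vertex_diff by (simp add: inner_diff_right)
      then show ?thesis
        unfolding z using dist_circumcenter[of _ UNIV]
        by (subst dist_le_iff_inner_le[of ctr]) auto
    qed
  qed (use sum_b in auto)
  then show ?thesis
    by (simp add: z)
qed

text \<open>The point is the midpoint of \<open>v i\<close> and the point of
  \<open>circumcenter_add_normal_in\<close>. These are the points at which the two Taylor expansions
  of the error bound meet.\<close>

lemma shifted_half_vertex_in:
  assumes "w \<in> T"
  shows "w - \<phi> w + u i \<in> T"
proof -
  have "(1/2) *\<^sub>R v i + (1/2) *\<^sub>R (ctr + 2 *\<^sub>R (w - \<phi> w)) \<in> T"
    using circumcenter_add_normal_in[OF assms]
    by (intro convexD[OF convex_convex_hull]) (auto simp: hull_inc)
  then show ?thesis
    by (simp add: half_vertex_def algebra_simps)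
qed

end

section \<open>Functions with nonexpansive gradient along segments\<close>

lemma has_real_derivative_along_line:
  fixes f :: "'a::real_inner \<Rightarrow> real"
  assumes "(f has_derivative (\<lambda>h. g \<bullet> h)) (at (x + t *\<^sub>R e) within T)"
    and "\<And>s. s \<in> S \<Longrightarrow> x + s *\<^sub>R e \<in> T"
  shows "((\<lambda>s. f (x + s *\<^sub>R e)) has_real_derivative g \<bullet> e) (at t within S)"
proof -
  have "((\<lambda>s. x + s *\<^sub>R e) has_derivative (\<lambda>s. s *\<^sub>R e)) (at t within S)"
    by (auto intro!: derivative_eq_intros)
  moreover have "(f has_derivative (\<lambda>h. g \<bullet> h)) (at (x + t *\<^sub>R e) within (\<lambda>s. x + s *\<^sub>R e) ` S)"
    using assms by (intro has_derivative_subset[OF assms(1)]) auto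
  ultimately have "((\<lambda>s. f (x + s *\<^sub>R e)) has_derivative (\<lambda>s. g \<bullet> (s *\<^sub>R e))) (at t within S)"
    by (rule has_derivative_in_compose)
  then show ?thesis
    by (simp add: has_field_derivative_def mult_commute_abs)
qed

lemma segment_in_convex:
  fixes x y :: "'a::real_normed_vector"
  assumes "convex T" and "x \<in> T" and "y \<in> T" and "0 \<le> s" and "s \<le> norm (y - x)"
  shows "x + (s / norm (y - x)) *\<^sub>R (y - x) \<in> T"
proof -
  have "0 \<le> s / norm (y - x)" "s / norm (y - x) \<le> 1"
    using assms(4,5) by (auto simp: divide_le_eq_1)
  then have "(1 - s / norm (y - x)) *\<^sub>R x + (s / norm (y - x)) *\<^sub>R y \<in> T"
    using assms by (intro convexD) auto
  then show ?thesis
    by (simp add: algebra_simps)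
qed

text \<open>The function \<open>g t - g' 0 * t - t^2 / 2\<close> has nonpositive derivative. The
  one-sided form can be used for \<open>g\<close> and for \<open>- g\<close>.\<close>

lemma second_order_upper_bound:
  fixes g g' :: "real \<Rightarrow> real"
  assumes "0 \<le> r"
    and der: "\<And>t. t \<in> {0..r} \<Longrightarrow> (g has_real_derivative g' t) (at t within {0..r})"
    and le: "\<And>t. t \<in> {0..r} \<Longrightarrow> g' t - g' 0 \<le> t"
  shows "g r - g 0 - g' 0 * r \<le> r\<^sup>2 / 2"
proof -
  let ?h = "\<lambda>t. g t - g' 0 * t - t\<^sup>2 / 2"
  have h: "(?h has_real_derivative g' t - g' 0 - t) (at t within {0..r})" if "t \<in> {0..r}" for t
    using der[OF that] by (auto intro!: derivative_eq_intros)
  have "?h r \<le> ?h 0"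
  proof (rule DERIV_nonpos_imp_decreasing_open[OF assms(1)])
    show "\<exists>y. DERIV ?h t :> y \<and> y \<le> 0" if "0 < t" "t < r" for t
    proof (intro exI conjI)
      show "DERIV ?h t :> g' t - g' 0 - t"
        using h[of t] that at_within_Icc_at[of 0 t r] by simp
      show "g' t - g' 0 - t \<le> 0"
        using le[of t] that by simp
    qed
    show "continuous_on {0..r} ?h"
      by (rule DERIV_continuous_on) (rule h)
  qed
  then show ?thesis
    by simp
qed

lemma W2inf_taylor:
  assumes "g \<in> W2inf 0 r" and "0 < r" and "(g has_real_derivative d) (at 0 within {0..r})"
  shows "\<bar>g r - g 0 - d * r\<bar> \<le> r\<^sup>2 / 2"
proof -
  obtain g' where der: "\<And>t. t \<in> {0..r} \<Longrightarrow> (g has_real_derivative g' t) (at t within {0..r})"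
    and lip: "\<And>s t. s \<in> {0..r} \<Longrightarrow> t \<in> {0..r} \<Longrightarrow> \<bar>g' s - g' t\<bar> \<le> \<bar>s - t\<bar>"
    using assms(1) unfolding W2inf_def by blast
  \<comment> \<open>The class provides its own derivative \<open>g'\<close>; identifying
    \<open>g' 0\<close> with the given \<open>d\<close> requires 0 to be a limit point of the
    interval.\<close>
  have "at 0 within {0..r} \<noteq> bot"
    using assms(2) by (simp add: at_within_Icc_at_right)
  then have d: "g' 0 = d"
    using der[of 0] assms(2,3) by (intro has_field_derivative_unique) auto
  have "g r - g 0 - g' 0 * r \<le> r\<^sup>2 / 2"
  proof (rule second_order_upper_bound)
    show "g' t - g' 0 \<le> t" if "t \<in> {0..r}" for t
      using lip[of t 0] that by auto
  qed (use assms(2) der in auto)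
  moreover have "(- g r) - (- g 0) - (- g' 0) * r \<le> r\<^sup>2 / 2"
  proof (rule second_order_upper_bound)
    show "(- g' t) - (- g' 0) \<le> t" if "t \<in> {0..r}" for t
      using lip[of t 0] that by auto
    show "((\<lambda>t. - g t) has_real_derivative - g' t) (at t within {0..r})" if "t \<in> {0..r}" for t
      using der[OF that] by (rule DERIV_minus)
  qed (use assms(2) in auto)
  ultimately show ?thesis
    unfolding d by linarith
qed

lemma W2_taylor:
  assumes "f \<in> W2 T" and "convex T" and "x \<in> T" and "y \<in> T"
    and "(f has_derivative (\<lambda>h. G \<bullet> h)) (at x within T)"
  shows "\<bar>f y - f x - G \<bullet> (y - x)\<bar> \<le> (norm (y - x))\<^sup>2 / 2"
proof (cases "x = y")
  case False
  define r where "r = norm (y - x)"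
  define e where "e = (1 / r) *\<^sub>R (y - x)"
  have r: "0 < r"
    using False by (simp add: r_def)
  have seg: "x + s *\<^sub>R e = x + (s / norm (y - x)) *\<^sub>R (y - x)" for s
    by (simp add: e_def r_def)
  have "(\<lambda>t. f (x + t *\<^sub>R e)) \<in> W2inf 0 r"
    using assms(1,3,4) False unfolding W2_def seg r_def by blast
  moreover have "((\<lambda>t. f (x + t *\<^sub>R e)) has_real_derivative G \<bullet> e) (at 0 within {0..r})"
  proof (rule has_real_derivative_along_line)
    show "(f has_derivative (\<lambda>h. G \<bullet> h)) (at (x + 0 *\<^sub>R e) within T)"
      using assms(5) by simp
    show "x + s *\<^sub>R e \<in> T" if "s \<in> {0..r}" for s
      using that assms(2-4) unfolding seg by (intro segment_in_convex) (auto simp: r_def)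
  qed
  ultimately have "\<bar>f (x + r *\<^sub>R e) - f (x + 0 *\<^sub>R e) - (G \<bullet> e) * r\<bar> \<le> r\<^sup>2 / 2"
    using r by (intro W2inf_taylor)
  then show ?thesis
    using r by (simp add: e_def) (simp add: r_def)
qed simp

text \<open>Membership test for the error function and its negative. Segments are traversed at unit
  speed, so pairing the gradient with the direction \<open>e\<close> preserves the Lipschitz
  constant 1.\<close>

lemma W2_if_lipschitz_gradient:
  fixes f :: "real ^ 'd::finite \<Rightarrow> real"
  assumes "convex T"
    and der: "\<And>x. x \<in> T \<Longrightarrow> (f has_derivative (\<lambda>h. G x \<bullet> h)) (at x within T)"
    and lip: "\<And>x y. x \<in> T \<Longrightarrow> y \<in> T \<Longrightarrow> norm (G x - G y) \<le> norm (x - y)"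
  shows "f \<in> W2 T"
proof -
  have "1-lipschitz_on T G"
    using lip by (auto simp: lipschitz_on_def dist_norm)
  then have "continuous_on T G"
    by (rule lipschitz_on_continuous_on)
  then have "f \<in> C1_fun T"
    using der unfolding C1_fun_def by blast
  moreover have "(\<lambda>t. f (x + (t / norm (y - x)) *\<^sub>R (y - x))) \<in> W2inf 0 (norm (y - x))"
    if "x \<in> T" "y \<in> T" "x \<noteq> y" for x y
  proof -
    define e where "e = (1 / norm (y - x)) *\<^sub>R (y - x)"
    have e: "norm e = 1"
      using that by (simp add: e_def)
    have seg: "x + s *\<^sub>R e = x + (s / norm (y - x)) *\<^sub>R (y - x)" for s
      by (simp add: e_def)
    have in_T: "x + s *\<^sub>R e \<in> T" if "s \<in> {0..norm (y - x)}" for s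
      using that \<open>x \<in> T\<close> \<open>y \<in> T\<close> assms(1) unfolding seg by (intro segment_in_convex) auto
    have der': "((\<lambda>t. f (x + t *\<^sub>R e)) has_real_derivative G (x + t *\<^sub>R e) \<bullet> e)
        (at t within {0..norm (y - x)})" if "t \<in> {0..norm (y - x)}" for t
      using that der in_T by (intro has_real_derivative_along_line[where T = T]) auto
    have lip': "\<bar>G (x + s *\<^sub>R e) \<bullet> e - G (x + t *\<^sub>R e) \<bullet> e\<bar> \<le> \<bar>s - t\<bar>"
      if "s \<in> {0..norm (y - x)}" "t \<in> {0..norm (y - x)}" for s t
    proof -
      have "\<bar>(G (x + s *\<^sub>R e) - G (x + t *\<^sub>R e)) \<bullet> e\<bar> \<le> norm (G (x + s *\<^sub>R e) - G (x + t *\<^sub>R e))"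
        using Cauchy_Schwarz_ineq2[of "G (x + s *\<^sub>R e) - G (x + t *\<^sub>R e)" e] e by simp
      also have "\<dots> \<le> norm ((x + s *\<^sub>R e) - (x + t *\<^sub>R e))"
        using that by (intro lip in_T)
      also have "\<dots> = norm ((s - t) *\<^sub>R e)"
        by (simp add: scaleR_left_diff_distrib)
      also have "\<dots> = \<bar>s - t\<bar>"
        using e by simp
      finally show ?thesis
        by (simp add: inner_diff_left)
    qed
    show ?thesis
      unfolding W2inf_def seg[symmetric]
      by (intro CollectI exI[of _ "\<lambda>t. G (x + t *\<^sub>R e) \<bullet> e"] conjI ballI der' lip')
  qed
  ultimately show ?thesis
    unfolding W2_def by blast
qed

section \<open>Uniqueness of gradients within the simplex\<close>

context nondegenerate
begin

text \<open>Two gradients agree on every direction from \<open>x\<close> to a point of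
  \<open>T\<close>. If they differed, \<open>T\<close> would lie in a hyperplane normal to their
  difference.\<close>

lemma gradient_unique:
  assumes "x \<in> T" and "(f has_derivative (\<lambda>h. G \<bullet> h)) (at x within T)"
    and "(f has_derivative (\<lambda>h. G' \<bullet> h)) (at x within T)"
  shows "G = G'"
proof (rule ccontr)
  assume "G \<noteq> G'"
  have "T \<subseteq> {y. (G - G') \<bullet> y = (G - G') \<bullet> x}"
  proof
    fix y assume "y \<in> T"
    have in_T: "x + s *\<^sub>R (y - x) \<in> T" if "s \<in> {0..1}" for s
    proof -
      have "(1 - s) *\<^sub>R x + s *\<^sub>R y \<in> T"
        using that \<open>x \<in> T\<close> \<open>y \<in> T\<close> by (intro convexD[OF convex_convex_hull]) auto
      then show ?thesis
        by (simp add: algebra_simps)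
    qed
    have "((\<lambda>s. f (x + s *\<^sub>R (y - x))) has_real_derivative G \<bullet> (y - x)) (at 0 within {0..1})"
      using assms(2) in_T by (intro has_real_derivative_along_line[where T = T]) auto
    moreover have "((\<lambda>s. f (x + s *\<^sub>R (y - x))) has_real_derivative G' \<bullet> (y - x)) (at 0 within {0..1})"
      using assms(3) in_T by (intro has_real_derivative_along_line[where T = T]) auto
    moreover have "at (0::real) within {0..1} \<noteq> bot"
      by (simp add: at_within_Icc_at_right)
    ultimately have "G \<bullet> (y - x) = G' \<bullet> (y - x)"
      by (rule has_field_derivative_unique)
    then show "y \<in> {y. (G - G') \<bullet> y = (G - G') \<bullet> x}"
      by (simp add: inner_diff)
  qed
  then show False
    using nondegenerate_simplex \<open>G \<noteq> G'\<close> unfolding nondegenerate_simplex_def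
    by (metis right_minus_eq)
qed

lemma grad_within_eq:
  assumes "x \<in> T" and "(f has_derivative (\<lambda>h. G \<bullet> h)) (at x within T)"
  shows "grad_within T f x = G"
  unfolding grad_within_def using assms gradient_unique by (intro the_equality) auto

lemma W2_has_gradient:
  assumes "f \<in> W2 T" and "x \<in> T"
  shows "(f has_derivative (\<lambda>h. grad_within T f x \<bullet> h)) (at x within T)"
proof -
  obtain G where "(f has_derivative (\<lambda>h. G \<bullet> h)) (at x within T)"
    using assms unfolding W2_def C1_fun_def by blast
  then show ?thesis
    using grad_within_eq[OF assms(2)] by simp
qed

section \<open>The error function\<close>

text \<open>The gradient of \<open>err_fun v\<close>: the squared distance to \<open>U\<close>
  contributes \<open>2 (w - \<phi> w)\<close> and the last term \<open>-(w - ctr)\<close>.\<close>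

definition err_grad :: "real ^ 'd \<Rightarrow> real ^ 'd" where
  "err_grad w = w + ctr - 2 *\<^sub>R \<phi> w"

text \<open>The squared distance to \<open>U\<close> is squeezed by using the nearest point of
  \<open>x\<close> as a competitor for \<open>y\<close> and vice versa. The result is a quadratic
  remainder, which gives differentiability of \<open>err_fun v\<close>.\<close>

lemma err_fun_taylor:
  "\<bar>err_fun v y - err_fun v x - err_grad x \<bullet> (y - x)\<bar> \<le> 2 * (norm (y - x))\<^sup>2"
proof -
  define h where "h = y - x"
  have y: "y = x + h"
    by (simp add: h_def)
  have closer: "(norm (a - \<phi> a))\<^sup>2 \<le> (norm (a - \<phi> b))\<^sup>2" for a b
    using closest_point_le[OF closed_half proj_half_in, of a b]
    by (simp add: proj_half_def dist_norm power_mono)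
  have "norm (\<phi> y - \<phi> x) \<le> norm h"
    using closest_point_lipschitz[OF convex_convex_hull closed_half half_nonempty, of y x]
    by (simp add: proj_half_def dist_norm h_def)
  then have "h \<bullet> (\<phi> y - \<phi> x) \<le> (norm h)\<^sup>2"
    using norm_cauchy_schwarz[of h "\<phi> y - \<phi> x"] mult_left_mono[of _ "norm h" "norm h"]
    by (fastforce simp: power2_eq_square)
  moreover have "(norm (y - \<phi> y))\<^sup>2 - (norm (x - \<phi> x))\<^sup>2 - 2 * ((x - \<phi> x) \<bullet> h) \<le> (norm h)\<^sup>2"
    using closer[of y x] unfolding y
    by (simp add: power2_norm_eq_inner inner_add inner_diff inner_commute)
  moreover have "(norm (y - \<phi> y))\<^sup>2 - (norm (x - \<phi> x))\<^sup>2 - 2 * ((x - \<phi> x) \<bullet> h) \<ge>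
      (norm h)\<^sup>2 - 2 * (h \<bullet> (\<phi> y - \<phi> x))"
  proof -
    have "(norm (y - \<phi> y))\<^sup>2 - (norm (x - \<phi> y))\<^sup>2 = (norm h)\<^sup>2 + 2 * (h \<bullet> (x - \<phi> y))"
      by (simp add: h_def power2_norm_eq_inner inner_diff inner_commute)
    moreover have "(x - \<phi> x) \<bullet> h = h \<bullet> (x - \<phi> y) + h \<bullet> (\<phi> y - \<phi> x)"
      by (simp add: inner_diff inner_commute)
    ultimately show ?thesis
      using closer[of x y] by linarith
  qed
  moreover have "err_fun v y - err_fun v x - err_grad x \<bullet> (y - x) =
      (norm (y - \<phi> y))\<^sup>2 - (norm (x - \<phi> x))\<^sup>2 - 2 * ((x - \<phi> x) \<bullet> h) - (norm h)\<^sup>2 / 2"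
  proof -
    have "(norm (y - ctr))\<^sup>2 = (norm (x - ctr))\<^sup>2 + 2 * ((x - ctr) \<bullet> h) + (norm h)\<^sup>2"
      by (simp add: h_def power2_norm_eq_inner inner_diff inner_commute)
    moreover have "err_grad x \<bullet> h = 2 * ((x - \<phi> x) \<bullet> h) - (x - ctr) \<bullet> h"
      by (simp add: err_grad_def inner_diff_left inner_add_left)
    ultimately show ?thesis
      unfolding err_fun_def h_def[symmetric] by linarith
  qed
  \<comment> \<open>The remainder lies between \<open>-3/2\<close> and \<open>1/2\<close> times the
    squared norm of \<open>h\<close>; the constant 2 is a convenient bound.\<close>
  ultimately show ?thesis
    using zero_le_power2[of "norm h"] unfolding h_def[symmetric] abs_le_iff by linarith
qed

lemma err_fun_has_derivative:
  "(err_fun v has_derivative (\<lambda>h. err_grad x \<bullet> h)) (at x within S)"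
proof (rule has_derivativeI_sandwich[of 1 _ _ _ _ "\<lambda>y. 2 * norm (y - x)"])
  show "bounded_linear (\<lambda>h. err_grad x \<bullet> h)"
    by (rule bounded_linear_inner_right)
  show "norm (err_fun v y - err_fun v x - err_grad x \<bullet> (y - x)) / norm (y - x) \<le> 2 * norm (y - x)"
    if "y \<noteq> x" for y
    using err_fun_taylor[of y x] that by (simp add: pos_divide_le_eq power2_eq_square)
  have "((\<lambda>y. 2 * norm (y - x)) \<longlongrightarrow> 2 * norm (x - x)) (at x within S)"
    by (intro tendsto_intros)
  then show "((\<lambda>y. 2 * norm (y - x)) \<longlongrightarrow> 0) (at x within S)"
    by simp
qed simp

lemma err_grad_nonexpansive: "norm (err_grad x - err_grad y) \<le> norm (x - y)"
proof -
  have "(norm (err_grad x - err_grad y))\<^sup>2 =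
      (norm (x - y))\<^sup>2 - 4 * (((x - \<phi> x) - (y - \<phi> y)) \<bullet> (\<phi> x - \<phi> y))"
    by (simp add: err_grad_def power2_norm_eq_inner inner_diff inner_add inner_commute)
  then have "(norm (err_grad x - err_grad y))\<^sup>2 \<le> (norm (x - y))\<^sup>2"
    using proj_half_nonexpansive[of x y] by linarith
  then show ?thesis
    by (simp add: abs_le_square_iff[symmetric])
qed

text \<open>The squared distance from \<open>v i\<close> to \<open>U\<close> is
  \<open>rad^2 / 4\<close>, so the two quarters cancel against the half.\<close>

lemma err_fun_vertex: "err_fun v (v i) = 0"
proof -
  have "(norm (v i - u i))\<^sup>2 = rad\<^sup>2 / 4"
    by (simp add: vertex_minus_half_vertex norm_vertex_diff power_divide)
  then show ?thesis
    by (simp add: err_fun_def proj_half_vertex norm_vertex_diff)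
qed

lemma err_grad_vertex: "err_grad (v i) = 0"
  by (simp add: err_grad_def proj_half_vertex half_vertex_def)

text \<open>These are the two fooling functions: members of the class that share the information
  vector 0 and hence receive the same answer from every method.\<close>

lemma
  shows err_fun_in_W2: "err_fun v \<in> W2 T"
    and minus_err_fun_in_W2: "(\<lambda>x. - err_fun v x) \<in> W2 T"
    and info_err_fun: "info v (err_fun v) = 0"
    and info_minus_err_fun: "info v (\<lambda>x. - err_fun v x) = 0"
proof -
  have minus: "((\<lambda>x. - err_fun v x) has_derivative (\<lambda>h. (- err_grad x) \<bullet> h)) (at x within T)" for x
    using has_derivative_minus[OF err_fun_has_derivative] by simp
  have minus_lip: "norm (- err_grad x - - err_grad y) \<le> norm (x - y)" for x y
    using err_grad_nonexpansive[of y x] by (simp add: norm_minus_commute)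
  show "err_fun v \<in> W2 T"
    by (rule W2_if_lipschitz_gradient[OF convex_convex_hull err_fun_has_derivative err_grad_nonexpansive])
  show "(\<lambda>x. - err_fun v x) \<in> W2 T"
    by (rule W2_if_lipschitz_gradient[OF convex_convex_hull minus minus_lip])
  have "grad_within T (err_fun v) (v i) = 0" for i
    using grad_within_eq[OF _ err_fun_has_derivative, of "v i"] by (simp add: hull_inc err_grad_vertex)
  then show "info v (err_fun v) = 0"
    by (simp add: info_def err_fun_vertex vec_eq_iff zero_prod_def)
  have "grad_within T (\<lambda>x. - err_fun v x) (v i) = 0" for i
    using grad_within_eq[OF _ minus, of "v i"] by (simp add: hull_inc err_grad_vertex)
  then show "info v (\<lambda>x. - err_fun v x) = 0"
    by (simp add: info_def err_fun_vertex vec_eq_iff zero_prod_def)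
qed

lemma recovery_eq_Psi_star: "recovery v f w = Psi_star v w (info v f)"
  by (simp add: recovery_def Psi_star_def info_def)

text \<open>This makes \<open>Phi_star v\<close> admissible in the infimum over methods. Passing to
  \<open>half_coord\<close> replaces a definite description by a composition of continuous
  maps.\<close>

lemma Phi_star_continuous: "Phi_star v yz \<in> cont_fun T"
proof -
  obtain y z where yz: "yz = (y, z)"
    by (cases yz)
  have "Phi_star v yz = (\<lambda>w. \<Sum>i\<in>UNIV. half_coord w i *
      (y $ i + z $ i \<bullet> (w - \<phi> w + (1/2) *\<^sub>R (ctr - v i))))"
    by (simp add: yz Phi_star_def Psi_star_def barycentric_half)
  then show ?thesis
    unfolding cont_fun_def
    by (auto intro!: continuous_intros continuous_half_coord continuous_proj_half)
qed

lemma err_fun_continuous: "err_fun v \<in> cont_fun T"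
  unfolding cont_fun_def
  using has_derivative_continuous[OF err_fun_has_derivative]
  by (auto simp: continuous_on_eq_continuous_within)

end

lemma W2_continuous: "f \<in> W2 T \<Longrightarrow> f \<in> cont_fun T"
  unfolding W2_def C1_fun_def cont_fun_def
  by (auto simp: continuous_on_eq_continuous_within intro: has_derivative_continuous)

section \<open>Optimality\<close>

context well_centered
begin

text \<open>Expansions from \<open>w\<close> and from \<open>v i\<close> meet at \<open>x i\<close>.
  The unknown \<open>G w\<close> drops out on averaging, since the weighted mean of the
  \<open>x i\<close> is \<open>w\<close>. Only Taylor inequalities are assumed of \<open>f\<close>
  and \<open>G\<close>, so the bound can be reused for \<open>- f\<close> and
  \<open>- G\<close>.\<close>

lemma one_sided_recovery_bound:
  fixes f :: "real ^ 'd \<Rightarrow> real" and G :: "real ^ 'd \<Rightarrow> real ^ 'd"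
  assumes w: "w \<in> T"
    and taylor: "\<And>x y. x \<in> T \<Longrightarrow> y \<in> T \<Longrightarrow> \<bar>f y - f x - G x \<bullet> (y - x)\<bar> \<le> (norm (y - x))\<^sup>2 / 2"
  shows "f w - (\<Sum>i\<in>UNIV. half_coord w i *
      (f (v i) + G (v i) \<bullet> (w - \<phi> w + (1/2) *\<^sub>R (ctr - v i)))) \<le> err_fun v w"
proof -
  define x where "x i = w - \<phi> w + u i" for i
  define b where "b = half_coord w"
  \<comment> \<open>In these vectors \<open>x i - w = a i - p\<close>,
    \<open>x i - v i = q - a i\<close> and \<open>w - ctr = p + q\<close>; moreover the
    \<open>a i\<close> have norm \<open>rad / 2\<close> and weighted mean \<open>p\<close>.\<close>
  define p where "p = \<phi> w - ctr"
  define q where "q = w - \<phi> w"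
  define a where "a i = u i - ctr" for i
  \<comment> \<open>The two Taylor remainders at \<open>x i\<close> add up to
    \<open>k - (p + q) \<bullet> a i\<close>: a constant plus a term linear in \<open>a i\<close>,
    whose weighted mean is known.\<close>
  define k where "k = rad\<^sup>2 / 4 + ((norm p)\<^sup>2 + (norm q)\<^sup>2) / 2"
  have x_in: "x i \<in> T" for i
    unfolding x_def by (rule shifted_half_vertex_in[OF w])
  have xv: "x i - v i = w - \<phi> w + (1/2) *\<^sub>R (ctr - v i)" for i
  proof -
    have "x i - v i = (w - \<phi> w) - (v i - u i)"
      by (simp add: x_def)
    then show ?thesis
      unfolding vertex_minus_half_vertex by (simp add: algebra_simps)
  qed
  have sum_b: "(\<Sum>i\<in>UNIV. b i) = 1"
    by (simp add: b_def sum_half_coord)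
  have sum_a: "(\<Sum>i\<in>UNIV. b i *\<^sub>R a i) = p"
    by (simp add: a_def p_def b_def scaleR_right_diff_distrib sum_subtractf
        sum_half_coord sum_half_coord_scaleR flip: scaleR_left.sum)
  have vertex_in: "v i \<in> T" for i
    by (simp add: hull_inc)
  have xw_a: "x i - w = a i - p" for i
    by (simp add: x_def a_def p_def)
  have xv_a: "x i - v i = q - a i" for i
    unfolding a_def half_vertex_diff vertex_minus_half_vertex[symmetric]
    by (simp add: x_def q_def)
  have norm_a: "(norm (a i))\<^sup>2 = rad\<^sup>2 / 4" for i
    by (simp add: a_def half_vertex_diff norm_vertex_diff power_divide)
  have "f w - (f (v i) + G (v i) \<bullet> (x i - v i)) \<le>
      G w \<bullet> (p - a i) + (k - (p + q) \<bullet> a i)" for i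
  proof -
    have "f w \<le> f (x i) - G w \<bullet> (x i - w) + (norm (x i - w))\<^sup>2 / 2"
      using taylor[OF w x_in[of i]] unfolding abs_le_iff by linarith
    moreover have "f (x i) \<le> f (v i) + G (v i) \<bullet> (x i - v i) + (norm (x i - v i))\<^sup>2 / 2"
      using taylor[OF vertex_in[of i] x_in[of i]] unfolding abs_le_iff by linarith
    moreover have "((norm (x i - w))\<^sup>2 + (norm (x i - v i))\<^sup>2) / 2 =
        (norm (a i))\<^sup>2 + ((norm p)\<^sup>2 + (norm q)\<^sup>2) / 2 - (p + q) \<bullet> a i"
      unfolding xw_a xv_a
      by (simp add: power2_norm_eq_inner inner_diff inner_add inner_commute field_simps)
    ultimately show ?thesis
      unfolding k_def norm_a xw_a inner_diff_right add_divide_distrib by (smt (verit))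
  qed
  then have "(\<Sum>i\<in>UNIV. b i * (f w - (f (v i) + G (v i) \<bullet> (x i - v i)))) \<le>
      (\<Sum>i\<in>UNIV. b i * (G w \<bullet> (p - a i) +
        (k - (p + q) \<bullet> a i)))"
    by (intro sum_mono mult_left_mono) (auto simp: b_def half_coord_nonneg)
  also have "\<dots> = G w \<bullet> ((\<Sum>i\<in>UNIV. b i) *\<^sub>R p - (\<Sum>i\<in>UNIV. b i *\<^sub>R a i)) +
      ((\<Sum>i\<in>UNIV. b i) * k -
        (p + q) \<bullet> (\<Sum>i\<in>UNIV. b i *\<^sub>R a i))"
    by (simp add: inner_diff_right inner_sum_right sum.distrib sum_subtractf sum_distrib_right
        distrib_left right_diff_distrib)
  also have "\<dots> = k - (p + q) \<bullet> p"
    by (simp add: sum_b sum_a)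
  also have "\<dots> = err_fun v w"
  proof -
    have "w - ctr = p + q"
      by (simp add: p_def q_def)
    then show ?thesis
      unfolding err_fun_def q_def[symmetric] k_def
      by (simp add: power2_norm_eq_inner inner_add inner_commute field_simps)
  qed
  finally show ?thesis
    by (simp add: right_diff_distrib sum_subtractf sum_b xv b_def sum_half_coord
        flip: sum_distrib_right)
qed

lemma recovery_error_le:
  assumes f: "f \<in> W2 T" and w: "w \<in> T"
  shows "\<bar>f w - recovery v f w\<bar> \<le> err_fun v w"
proof -
  let ?G = "grad_within T f"
  have taylor: "\<bar>f y - f x - ?G x \<bullet> (y - x)\<bar> \<le> (norm (y - x))\<^sup>2 / 2" if "x \<in> T" "y \<in> T" for x y
    by (rule W2_taylor[OF f convex_convex_hull that W2_has_gradient[OF f that(1)]])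
  have rec: "recovery v f w = (\<Sum>i\<in>UNIV. half_coord w i *
      (f (v i) + ?G (v i) \<bullet> (w - \<phi> w + (1/2) *\<^sub>R (ctr - v i))))"
    by (simp add: recovery_def barycentric_half)
  have "f w - recovery v f w \<le> err_fun v w"
    unfolding rec by (rule one_sided_recovery_bound[OF w taylor])
  \<comment> \<open>Negating the function and its gradient negates the recovered value, so the same
    bound supplies the other side.\<close>
  moreover have "(- f w) - (\<Sum>i\<in>UNIV. half_coord w i *
      ((- f (v i)) + (- ?G (v i)) \<bullet> (w - \<phi> w + (1/2) *\<^sub>R (ctr - v i)))) \<le> err_fun v w"
  proof (rule one_sided_recovery_bound[OF w])
    show "\<bar>(- f y) - (- f x) - (- ?G x) \<bullet> (y - x)\<bar> \<le> (norm (y - x))\<^sup>2 / 2"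
      if "x \<in> T" "y \<in> T" for x y
      using taylor[OF that] unfolding inner_minus_left by linarith
  qed
  moreover have "(\<Sum>i\<in>UNIV. half_coord w i *
      ((- f (v i)) + (- ?G (v i)) \<bullet> (w - \<phi> w + (1/2) *\<^sub>R (ctr - v i)))) = - recovery v f w"
    unfolding rec sum_negf[symmetric] by (intro sum.cong) (simp_all add: algebra_simps)
  ultimately show ?thesis
    by linarith
qed

lemma pointwise_optimality:
  assumes w: "w \<in> T"
  shows "point_error v w (Psi_star v w) = ereal (err_fun v w)"
    and "optimal_point_error v w = ereal (err_fun v w)"
proof -
  have le: "point_error v w (Psi_star v w) \<le> ereal (err_fun v w)"
    unfolding point_error_def
    using recovery_error_le[OF _ w] by (intro SUP_least) (simp add: recovery_eq_Psi_star)
  \<comment> \<open>Any method returns the single value \<open>\<Psi> 0\<close> for both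
    \<open>err_fun v\<close> and its negative. Their values at \<open>w\<close> differ by twice
    \<open>err_fun v w\<close>, so at least one of the errors is no smaller than
    \<open>err_fun v w\<close>.\<close>
  have ge: "ereal (err_fun v w) \<le> point_error v w \<Psi>" for \<Psi>
  proof -
    have "ereal \<bar>err_fun v w - \<Psi> 0\<bar> \<le> point_error v w \<Psi>"
      unfolding point_error_def
      using SUP_upper[OF err_fun_in_W2, of "\<lambda>f. ereal \<bar>f w - \<Psi> (info v f)\<bar>"]
      by (simp add: info_err_fun)
    moreover have "ereal \<bar>- err_fun v w - \<Psi> 0\<bar> \<le> point_error v w \<Psi>"
      unfolding point_error_def
      using SUP_upper[OF minus_err_fun_in_W2, of "\<lambda>f. ereal \<bar>f w - \<Psi> (info v f)\<bar>"]
      by (simp add: info_minus_err_fun)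
    moreover have "err_fun v w \<le> \<bar>err_fun v w - \<Psi> 0\<bar> \<or> err_fun v w \<le> \<bar>- err_fun v w - \<Psi> 0\<bar>"
      by linarith
    ultimately show ?thesis
      by (meson ereal_less_eq(3) order_trans)
  qed
  show "point_error v w (Psi_star v w) = ereal (err_fun v w)"
    using le ge by (rule antisym)
  show "optimal_point_error v w = ereal (err_fun v w)"
    unfolding optimal_point_error_def
    by (intro antisym INF_greatest ge INF_lower2[of "Psi_star v w"] le) simp
qed

lemma global_optimality:
  assumes N: "monotone_seminorm T N"
  shows "global_error v N (Phi_star v) = ereal (N (err_fun v))"
    and "optimal_global_error v N = ereal (N (err_fun v))"
proof -
  have mono: "N f \<le> N g" if "f \<in> cont_fun T" "g \<in> cont_fun T" "\<And>x. x \<in> T \<Longrightarrow> \<bar>f x\<bar> \<le> \<bar>g x\<bar>" for f g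
    using N that unfolding monotone_seminorm_def by blast
  have scale: "N (\<lambda>x. a * f x) = \<bar>a\<bar> * N f" if "f \<in> cont_fun T" for f a
    using N that unfolding monotone_seminorm_def seminorm_cont_def by blast
  have add: "N (\<lambda>x. f x + g x) \<le> N f + N g" if "f \<in> cont_fun T" "g \<in> cont_fun T" for f g
    using N that unfolding monotone_seminorm_def seminorm_cont_def by blast
  have diff_cont: "(\<lambda>x. f x - g x) \<in> cont_fun T" if "f \<in> cont_fun T" "g \<in> cont_fun T" for f g
    using that by (auto simp: cont_fun_def intro: continuous_on_diff)
  have le: "global_error v N (Phi_star v) \<le> ereal (N (err_fun v))"
    unfolding global_error_def
  proof (rule SUP_least)
    fix f assume f: "f \<in> W2 T"
    have "\<bar>f x - Phi_star v (info v f) x\<bar> \<le> \<bar>err_fun v x\<bar>" if "x \<in> T" for x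
      using recovery_error_le[OF f that] by (simp add: Phi_star_def recovery_eq_Psi_star)
    then have "N (\<lambda>x. f x - Phi_star v (info v f) x) \<le> N (err_fun v)"
      using f by (intro mono diff_cont W2_continuous Phi_star_continuous err_fun_continuous)
    then show "ereal (N (\<lambda>x. f x - Phi_star v (info v f) x)) \<le> ereal (N (err_fun v))"
      by simp
  qed
  have ge: "ereal (N (err_fun v)) \<le> global_error v N \<Phi>" if \<Phi>: "range \<Phi> \<subseteq> cont_fun T" for \<Phi>
  proof -
    let ?E = "err_fun v" and ?h = "\<Phi> 0"
    have h: "?h \<in> cont_fun T"
      using \<Phi> by auto
    have E: "?E \<in> cont_fun T" "(\<lambda>x. - ?E x) \<in> cont_fun T"
      using err_fun_continuous W2_continuous[OF minus_err_fun_in_W2] by auto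
    have c1: "(\<lambda>x. ?E x - ?h x) \<in> cont_fun T" and c2: "(\<lambda>x. - ?E x - ?h x) \<in> cont_fun T"
      using diff_cont[OF E(1) h] diff_cont[OF E(2) h] by simp_all
    have c2': "(\<lambda>x. (-1) * (- ?E x - ?h x)) \<in> cont_fun T"
      using c2 unfolding cont_fun_def mem_Collect_eq
      by (intro continuous_on_mult continuous_on_const)
    \<comment> \<open>Twice the error function is the difference of the two errors that
      \<open>\<Phi>\<close> makes on the fooling functions. It is written as a sum with factor -1 to
      match the seminorm axioms.\<close>
    have "2 * N ?E = N (\<lambda>x. 2 * ?E x)"
      using scale[OF E(1), of 2] by simp
    also have "(\<lambda>x. 2 * ?E x) = (\<lambda>x. (?E x - ?h x) + (-1) * (- ?E x - ?h x))"
      by auto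
    also have "N \<dots> \<le> N (\<lambda>x. ?E x - ?h x) + N (\<lambda>x. (-1) * (- ?E x - ?h x))"
      by (rule add[OF c1 c2'])
    also have "N (\<lambda>x. (-1) * (- ?E x - ?h x)) = N (\<lambda>x. - ?E x - ?h x)"
      using scale[OF c2, of "-1"] by simp
    finally have "N ?E \<le> N (\<lambda>x. ?E x - ?h x) \<or> N ?E \<le> N (\<lambda>x. - ?E x - ?h x)"
      by linarith
    moreover have "ereal (N (\<lambda>x. ?E x - ?h x)) \<le> global_error v N \<Phi>"
      unfolding global_error_def
      using SUP_upper[OF err_fun_in_W2, of "\<lambda>f. ereal (N (\<lambda>x. f x - \<Phi> (info v f) x))"]
      by (simp add: info_err_fun)
    moreover have "ereal (N (\<lambda>x. - ?E x - ?h x)) \<le> global_error v N \<Phi>"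
      unfolding global_error_def
      using SUP_upper[OF minus_err_fun_in_W2, of "\<lambda>f. ereal (N (\<lambda>x. f x - \<Phi> (info v f) x))"]
      by (simp add: info_minus_err_fun)
    ultimately show ?thesis
      by (meson ereal_less_eq(3) order_trans)
  qed
  have Phi_star: "range (Phi_star v) \<subseteq> cont_fun T"
    using Phi_star_continuous by auto
  show "global_error v N (Phi_star v) = ereal (N (err_fun v))"
    using le ge[OF Phi_star] by (rule antisym)
  show "optimal_global_error v N = ereal (N (err_fun v))"
    unfolding optimal_global_error_def
    using Phi_star by (intro antisym INF_greatest ge INF_lower2[of "Phi_star v"] le) auto
qed

end

theorem corollary4p2:
  fixes v :: "'i::finite \<Rightarrow> real ^ 'd::finite"
  assumes "CARD('i) = CARD('d) + 1"
    and "nondegenerate_simplex v"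
    and "completely_well_centered v"
  shows "(\<forall>w \<in> simplex_hull v.
            (\<forall>f \<in> W2 (simplex_hull v). recovery v f w = Psi_star v w (info v f)) \<and>
            point_error v w (Psi_star v w) = optimal_point_error v w \<and>
            optimal_point_error v w = ereal (err_fun v w)) \<and>
         (\<forall>N. monotone_seminorm (simplex_hull v) N \<longrightarrow>
            range (Phi_star v) \<subseteq> cont_fun (simplex_hull v) \<and>
            (\<forall>f \<in> W2 (simplex_hull v). \<forall>w \<in> simplex_hull v.
               recovery v f w = Phi_star v (info v f) w) \<and>
            global_error v N (Phi_star v) = optimal_global_error v N \<and>
            optimal_global_error v N = ereal (N (err_fun v)))"
proof -
  interpret well_centered v
    using assms by unfold_locales
  have "range (Phi_star v) \<subseteq> cont_fun (simplex_hull v)"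
    using Phi_star_continuous by auto
  then show ?thesis
    by (simp add: pointwise_optimality global_optimality recovery_eq_Psi_star Phi_star_def)
qed

end
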